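(* Let $\mathcal{E}=\{(z,z+1): z\in\mathcal{Z}\}\cup\{(z,0): z\in\mathcal{Z}\setminus\{0\}\}$, and let $\lambda_{z,z'}:\mathcal{M}_1(\mathcal{Z})\to\mathbb{R}_+$, $(z,z')\in\mathcal{E}$, be such that there exist positive constants $\overline{\lambda},\underline{\lambda}$ with, for all $\xi\in\mathcal{M}_1(\mathcal{Z})$, $\frac{\underline{\lambda}}{z+1}\le\lambda_{z,z+1}(\xi)\le\frac{\overline{\lambda}}{z+1}$ for all $z\in\mathcal{Z}$ and $\underline{\lambda}\le\lambda_{z,0}(\xi)\le\overline{\lambda}$ for all $z\in\mathcal{Z}\setminus\{0\}$. Then for each $N\ge1$ the generator $\mathscr{L}^N$ admits a unique invariant probability measure $\wp^N$. Further, the family $\{\wp^N,N\ge1\}$ is exponentially tight in $\mathcal{M}_1(\mathcal{Z})$.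
   Context: $\mathcal{Z}=\{0,1,2,\dots\}$. $\mathcal{M}_1(\mathcal{Z})$ is the set of probability measures on $\mathcal{Z}$ with the total variation metric. $\mathcal{M}_1^N(\mathcal{Z})\subset\mathcal{M}_1(\mathcal{Z})$ is the set of empirical measures of $N$-particle configurations in $\mathcal{Z}^N$. The generator $\mathscr{L}^N$ acts on functions $f$ on $\mathcal{M}_1^N(\mathcal{Z})$ by $$\mathscr{L}^Nf(\xi)=\sum_{(z,z')\in\mathcal{E}}N\xi(z)\lambda_{z,z'}(\xi)\left[f\left(\xi+\tfrac{\delta_{z'}}{N}-\tfrac{\delta_z}{N}\right)-f(\xi)\right],\quad \xi\in\mathcal{M}_1^N(\mathcal{Z}),$$ and its invariant measure is viewed as a probability measure on $\mathcal{M}_1(\mathcal{Z})$. Exponential tightness means: for every $M>0$ there is a compact $K\subset\mathcal{M}_1(\mathcal{Z})$ with $\limsup_{N\to\infty}\frac1N\log\wp^N(\mathcal{M}_1(\mathcal{Z})\setminus K)\le-M$. *)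

theory Defs
  imports "HOL-Probability.Probability"
begin

section \<open>The total variation metric on probability measures\<close>

text \<open>Since \<open>\<Z> = {0, 1, 2, \<dots>}\<close> is the type \<^typ>\<open>nat\<close>, the set of all probability
  measures on it is the type \<^typ>\<open>nat pmf\<close>.\<close>

definition tv_dist :: "'a pmf \<Rightarrow> 'a pmf \<Rightarrow> real" where
  "tv_dist p q = (SUP A. \<bar>measure_pmf.prob p A - measure_pmf.prob q A\<bar>)"

lemma tv_dist_bdd:
  "bdd_above (range (\<lambda>A. \<bar>measure_pmf.prob p A - measure_pmf.prob q A\<bar>))"
proof (rule bdd_aboveI2)
  fix A
  have "0 \<le> measure_pmf.prob p A" "measure_pmf.prob p A \<le> 1"
       "0 \<le> measure_pmf.prob q A" "measure_pmf.prob q A \<le> 1"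
    by simp_all
  then show "\<bar>measure_pmf.prob p A - measure_pmf.prob q A\<bar> \<le> 1"
    by linarith
qed

lemma tv_dist_upper:
  "\<bar>measure_pmf.prob p A - measure_pmf.prob q A\<bar> \<le> tv_dist p q"
  unfolding tv_dist_def by (rule cSUP_upper[OF UNIV_I tv_dist_bdd])

lemma tv_dist_least:
  assumes "\<And>A. \<bar>measure_pmf.prob p A - measure_pmf.prob q A\<bar> \<le> c"
  shows "tv_dist p q \<le> c"
  unfolding tv_dist_def by (rule cSUP_least) (use assms in auto)

interpretation tv: Metric_space UNIV "tv_dist :: 'a pmf \<Rightarrow> 'a pmf \<Rightarrow> real"
proof
  fix p q r :: "'a pmf"
  show "0 \<le> tv_dist p q"
    using tv_dist_upper[of p "{}" q] by simp
  show "tv_dist p q = tv_dist q p"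
    unfolding tv_dist_def by (simp add: abs_minus_commute)
  show "tv_dist p q = 0 \<longleftrightarrow> p = q"
  proof
    assume "tv_dist p q = 0"
    then have "measure_pmf.prob p {x} = measure_pmf.prob q {x}" for x
      using tv_dist_upper[of p "{x}" q] by simp
    then show "p = q"
      by (intro pmf_eqI) (simp add: measure_pmf_single)
  qed (simp add: tv_dist_def)
  show "tv_dist p r \<le> tv_dist p q + tv_dist q r"
  proof (rule tv_dist_least)
    fix A
    show "\<bar>measure_pmf.prob p A - measure_pmf.prob r A\<bar> \<le> tv_dist p q + tv_dist q r"
      using tv_dist_upper[of p A q] tv_dist_upper[of q A r] by linarith
  qed
qed


section \<open>The mean-field particle system\<close>

text \<open>A configuration in \<open>\<Z>\<^sup>N\<close> is a list of length \<open>N\<close>; the mass that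
  \<^const>\<open>pmf_of_multiset\<close> gives to a state is the fraction of the particles in that state.\<close>

definition empirical_measures :: "nat \<Rightarrow> nat pmf set" where
  "empirical_measures N = {pmf_of_multiset (mset xs) |xs. length xs = N}"

definition edges :: "(nat \<times> nat) set" where
  "edges = {(z, z + 1) |z. True} \<union> {(z, 0) |z. z \<noteq> 0}"

text \<open>The measure \<open>\<xi> + \<delta>\<^bsub>z'\<^esub>/N - \<delta>\<^bsub>z\<^esub>/N\<close>. It is a probability measure only if \<open>\<xi>(z) \<ge> 1/N\<close>
  (or \<open>z = z'\<close>); in the generator the other terms carry the factor \<open>\<xi>(z) = 0\<close>.\<close>

definition jump :: "nat \<Rightarrow> nat \<Rightarrow> nat \<Rightarrow> nat pmf \<Rightarrow> nat pmf" where
  "jump N z z' \<xi> = embed_pmf (\<lambda>x. pmf \<xi> x + indicator {z'} x / real N - indicator {z} x / real N)"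

lemma pmf_jump:
  assumes N: "N \<ge> 1" and z: "pmf \<xi> z \<ge> 1 / real N"
  shows "pmf (jump N z z' \<xi>) x = pmf \<xi> x + indicator {z'} x / real N - indicator {z} x / real N"
proof -
  let ?g = "\<lambda>x. pmf \<xi> x + indicator {z'} x / real N - indicator {z} x / real N"
  have nonneg: "0 \<le> ?g x" for x
    using z by (auto simp: indicator_def)
  have pmf1: "has_bochner_integral (count_space UNIV) (pmf q) 1" for q :: "nat pmf"
    by (simp add: has_bochner_integral_iff integrable_pmf integral_pmf)
  have ind: "indicator {a} = pmf (return_pmf a)" for a :: nat
    by (auto simp: indicator_def fun_eq_iff)
  have "has_bochner_integral (count_space UNIV) ?g (1 + 1 / real N - 1 / real N)"
    by (intro has_bochner_integral_add has_bochner_integral_diff has_bochner_integral_divide_zero)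
       (simp_all only: ind pmf1)
  then have "integrable (count_space UNIV) ?g" "integral\<^sup>L (count_space UNIV) ?g = 1"
    by (simp_all add: has_bochner_integral_iff)
  then have "(\<integral>\<^sup>+ x. ennreal (?g x) \<partial>count_space UNIV) = 1"
    using nonneg by (subst nn_integral_eq_integral) (auto intro!: AE_I2)
  then show ?thesis
    unfolding jump_def using nonneg by (subst pmf_embed_pmf) auto
qed

lemma jump_pmf_of_multiset:
  assumes "size M = N" and z: "z \<in># M"
  shows "jump N z z' (pmf_of_multiset M) = pmf_of_multiset (add_mset z' (M - {#z#}))"
proof (rule pmf_eqI)
  fix x
  have M: "M \<noteq> {#}" and cnt: "count M z \<ge> 1"
    using z by auto
  have N: "N \<ge> 1"
    using M assms(1) by (simp add: Suc_leI nonempty_has_size)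
  have "size (add_mset z' (M - {#z#})) = N"
    using assms N by (simp add: size_Diff_singleton)
  moreover have "real (count (add_mset z' (M - {#z#})) x)
      = real (count M x) + indicator {z'} x - indicator {z} x"
    using cnt by (auto simp: indicator_def of_nat_diff)
  moreover have "1 / real N \<le> pmf (pmf_of_multiset M) z"
    using M assms(1) cnt by (simp add: divide_right_mono)
  ultimately show "pmf (jump N z z' (pmf_of_multiset M)) x
      = pmf (pmf_of_multiset (add_mset z' (M - {#z#}))) x"
    using M assms(1) N
    by (simp add: pmf_jump add_divide_distrib diff_divide_distrib del: count_add_mset size_add_mset)
qed

text \<open>For \<open>\<xi>\<close> in \<^term>\<open>empirical_measures N\<close> only finitely many terms of this sum are nonzero,
  and the jump targets in them lie in \<^term>\<open>empirical_measures N\<close> again. Values of \<open>f\<close> and of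
  \<open>generator N lam f\<close> outside \<^term>\<open>empirical_measures N\<close> are irrelevant.\<close>

definition generator ::
  "nat \<Rightarrow> (nat \<Rightarrow> nat \<Rightarrow> nat pmf \<Rightarrow> real) \<Rightarrow> (nat pmf \<Rightarrow> real) \<Rightarrow> nat pmf \<Rightarrow> real" where
  "generator N lam f \<xi> =
     (\<Sum>\<^sub>\<infinity>(z, z')\<in>edges. real N * pmf \<xi> z * lam z z' \<xi> * (f (jump N z z' \<xi>) - f \<xi>))"

text \<open>When the total jump rate is bounded on \<^term>\<open>empirical_measures N\<close>, the generator is a
  bounded operator on the bounded functions there, and the transition semigroup of the jump
  process it generates is the operator exponential \<open>exp (t \<L>\<^sup>N)\<close>.\<close>

definition transition_semigroup ::
  "nat \<Rightarrow> (nat \<Rightarrow> nat \<Rightarrow> nat pmf \<Rightarrow> real) \<Rightarrow> real \<Rightarrow> (nat pmf \<Rightarrow> real) \<Rightarrow> nat pmf \<Rightarrow> real" where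
  "transition_semigroup N lam t f \<xi> = (\<Sum>n. t ^ n / fact n * (generator N lam ^^ n) f \<xi>)"

text \<open>The set \<^term>\<open>empirical_measures N\<close> is countable, so a probability measure on it is a
  \<^typ>\<open>nat pmf pmf\<close> supported there.\<close>

definition invariant_measure ::
  "nat \<Rightarrow> (nat \<Rightarrow> nat \<Rightarrow> nat pmf \<Rightarrow> real) \<Rightarrow> nat pmf pmf \<Rightarrow> bool" where
  "invariant_measure N lam \<mu> \<longleftrightarrow>
     set_pmf \<mu> \<subseteq> empirical_measures N \<and>
     (\<forall>f t. bounded (f ` empirical_measures N) \<and> t \<ge> 0 \<longrightarrow>
        measure_pmf.expectation \<mu> (transition_semigroup N lam t f) = measure_pmf.expectation \<mu> f)"


section \<open>Exponential tightness\<close>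

text \<open>The logarithm with \<open>log 0 = -\<infinity>\<close>, whereas \<^term>\<open>ln 0 = (0::real)\<close> in HOL.\<close>

definition elog :: "real \<Rightarrow> ereal" where
  "elog x = (if x = 0 then -\<infinity> else ereal (ln x))"

definition exponentially_tight :: "(nat \<Rightarrow> 'a pmf pmf) \<Rightarrow> bool" where
  "exponentially_tight P \<longleftrightarrow>
     (\<forall>M>0. \<exists>K. compactin tv.mtopology K \<and>
        limsup (\<lambda>N. ereal (1 / real N) * elog (measure_pmf.prob (P N) (UNIV - K))) \<le> ereal (- M))"

end

(*
Uniformization turns invariance for the bounded generator L^N into stationarity for a discrete chain
on empirical measures. Since every particle falls back to 0 at a rate bounded below, N steps of that
chain reach the state "all particles at 0" with a probability bounded below, so by Doeblin's argument
the N-step operator contracts total variation: Banach's theorem gives the unique invariant measure.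

For tightness put T(x) = x(x+1)/2 and let e_k be the k-th elementary symmetric function of
T(x_1), ..., T(x_N). The increments T(x+1) - T(x) = x+1 cancel the upward rates 1/(x+1), which gives
  L^N e_k <= upper (N-k+1) e_(k-1) - lower k e_k.
Integrating against the invariant measure, E e_k <= (upper/lower)^k (N choose k); summing over k,
  E prod_i (1 + T(x_i)) <= (1 + upper/lower)^N.
T is truncated first, since invariance is only known for bounded functions. By Markov's inequality
the mean of ln (1 + T) under the empirical measure is at most R up to an event of probability at most
((1 + upper/lower) exp(-R))^N, and such a bound makes the tails uniformly small.
*)

theory Submission
  imports Defs "HOL-Computational_Algebra.Polynomial"
begin

section \<open>Probability mass functions in total variation\<close>

lemma integrable_pmf_bounded [intro]:
  fixes g :: "'a \<Rightarrow> real"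
  assumes "\<And>x. x \<in> set_pmf p \<Longrightarrow> \<bar>g x\<bar> \<le> C"
  shows "integrable (measure_pmf p) g"
  using assms by (intro measure_pmf.integrable_const_bound[where B = C]) (auto simp: AE_measure_pmf_iff)

text \<open>For fixed \<open>p\<close> and \<open>q\<close> the difference is largest when
  \<open>g\<close> equals \<open>C\<close> where \<open>p\<close> has at least the mass of
  \<open>q\<close> and vanishes elsewhere; for that choice it is \<open>C\<close> times a difference
  of probabilities of \<open>D\<close>.\<close>

lemma expectation_diff_le_tv_dist:
  fixes g :: "'a \<Rightarrow> real"
  assumes g: "\<And>x. 0 \<le> g x" "\<And>x. g x \<le> C"
  shows "measure_pmf.expectation p g - measure_pmf.expectation q g \<le> C * tv_dist p q"
proof -
  define D where "D = {x. pmf q x \<le> pmf p x}"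
  have C: "0 \<le> C"
    using g order_trans by blast
  have E: "measure_pmf.expectation r h = (LINT x|count_space UNIV. pmf r x * h x)"
    for r and h :: "'a \<Rightarrow> real"
    by (simp add: measure_pmf_eq_density integral_density)
  have I: "integrable (count_space UNIV) (\<lambda>x. pmf r x * h x)" if "\<And>x. \<bar>h x\<bar> \<le> B" for r B and h :: "'a \<Rightarrow> real"
    using that integrable_pmf_bounded[of r h B]
    by (simp add: measure_pmf_eq_density integrable_density)
  have ind: "\<bar>C * indicator D x\<bar> \<le> C" for x
    using C by (simp add: indicator_def)
  have gabs: "\<bar>g x\<bar> \<le> C" for x
    using g[of x] by simp
  have "measure_pmf.expectation p g - measure_pmf.expectation q g
      = (LINT x|count_space UNIV. pmf p x * g x - pmf q x * g x)"
    unfolding E by (intro Bochner_Integration.integral_diff[symmetric] I[of g C] gabs)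
  also have "\<dots> \<le> (LINT x|count_space UNIV. pmf p x * (C * indicator D x) - pmf q x * (C * indicator D x))"
  proof (intro integral_mono Bochner_Integration.integrable_diff I[of g C] I[of "\<lambda>x. C * indicator D x" C] gabs ind)
    fix x
    show "pmf p x * g x - pmf q x * g x \<le> pmf p x * (C * indicator D x) - pmf q x * (C * indicator D x)"
    proof (cases "x \<in> D")
      case True
      then have "(pmf p x - pmf q x) * g x \<le> (pmf p x - pmf q x) * C"
        using g by (intro mult_left_mono) (auto simp: D_def)
      then show ?thesis using True by (simp add: algebra_simps)
    next
      case False
      then have "(pmf p x - pmf q x) * g x \<le> 0"
        using g by (intro mult_nonpos_nonneg) (auto simp: D_def)
      then show ?thesis using False by (simp add: algebra_simps)
    qed
  qed
  also have "\<dots> = measure_pmf.expectation p (\<lambda>x. C * indicator D x) - measure_pmf.expectation q (\<lambda>x. C * indicator D x)"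
    unfolding E by (intro Bochner_Integration.integral_diff I[of "\<lambda>x. C * indicator D x" C] ind)
  also have "\<dots> = C * (measure_pmf.prob p D - measure_pmf.prob q D)"
    by (simp add: right_diff_distrib)
  also have "\<dots> \<le> C * tv_dist p q"
    using tv_dist_upper[of p D q] C by (intro mult_left_mono) auto
  finally show ?thesis .
qed

lemma prob_bind_pmf:
  "measure_pmf.prob (bind_pmf p Q) A = measure_pmf.expectation p (\<lambda>x. measure_pmf.prob (Q x) A)"
proof -
  have "measure_pmf.prob (bind_pmf p Q) A = measure_pmf.expectation (bind_pmf p Q) (indicator A)"
    by simp
  also have "\<dots> = measure_pmf.expectation p (\<lambda>x. measure_pmf.expectation (Q x) (indicator A))"
    unfolding measure_pmf_bind
    by (subst integral_bind[where K = "count_space UNIV" and B' = 1 and B = 1])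
       (auto simp: measure_pmf.emeasure_space_1 measure_pmf_in_subprob_space)
  finally show ?thesis by simp
qed

text \<open>Doeblin's estimate. As a function of the starting point, the probability of
  \<open>A\<close> after one step stays in an interval of length \<open>1 - \<epsilon>\<close>: in
  \<open>[0, 1 - \<epsilon>]\<close> if \<open>a\<close> is outside \<open>A\<close>, in
  \<open>[\<epsilon>, 1]\<close> otherwise.\<close>

lemma tv_dist_bind_minorized:
  assumes eps: "\<And>x. \<epsilon> \<le> pmf (Q x) a"
  shows "tv_dist (bind_pmf p Q) (bind_pmf q Q) \<le> (1 - \<epsilon>) * tv_dist p q"
proof (rule tv_dist_least)
  fix A
  have half: "measure_pmf.prob (bind_pmf p Q) A - measure_pmf.prob (bind_pmf q Q) A \<le> (1 - \<epsilon>) * tv_dist p q"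
    for p q
  proof (cases "a \<in> A")
    case False
    have "measure_pmf.prob (Q x) A \<le> 1 - \<epsilon>" for x
    proof -
      have "measure_pmf.prob (Q x) A \<le> measure_pmf.prob (Q x) (UNIV - {a})"
        using False by (intro measure_pmf.finite_measure_mono) auto
      also have "\<dots> = 1 - pmf (Q x) a"
        by (subst measure_pmf.prob_compl[of "{a}" "Q x", simplified]) (auto simp: measure_pmf_single)
      finally show ?thesis using eps[of x] by simp
    qed
    then show ?thesis
      unfolding prob_bind_pmf by (intro expectation_diff_le_tv_dist) auto
  next
    case True
    let ?g = "\<lambda>x. measure_pmf.prob (Q x) A"
    have lo: "\<epsilon> \<le> ?g x" for x
    proof -
      have "pmf (Q x) a \<le> ?g x"
        using True by (subst measure_pmf_single[symmetric]) (intro measure_pmf.finite_measure_mono, auto)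
      then show ?thesis using eps[of x] by simp
    qed
    have int: "integrable (measure_pmf r) ?g" for r
      by (rule integrable_pmf_bounded[where C = 1]) simp
    \<comment> \<open>Shifting by \<open>\<epsilon>\<close> moves the range down to
      \<open>[0, 1 - \<epsilon>]\<close>; the constant cancels between the two expectations.\<close>
    have "measure_pmf.expectation p (\<lambda>x. ?g x - \<epsilon>) - measure_pmf.expectation q (\<lambda>x. ?g x - \<epsilon>)
        \<le> (1 - \<epsilon>) * tv_dist p q"
      using lo by (intro expectation_diff_le_tv_dist) auto
    then show ?thesis
      unfolding prob_bind_pmf using int by simp
  qed
  show "\<bar>measure_pmf.prob (bind_pmf p Q) A - measure_pmf.prob (bind_pmf q Q) A\<bar> \<le> (1 - \<epsilon>) * tv_dist p q"
    using half[of p q] half[of q p] tv.commute[of p q] by (simp add: abs_le_iff)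
qed

section \<open>Completeness and total boundedness in total variation\<close>

lemma exists_finite_prob_ge:
  fixes p :: "'a pmf"
  assumes "\<epsilon> > 0"
  obtains F where "finite F" "measure_pmf.prob p F \<ge> 1 - \<epsilon>"
proof -
  define A where "A n = from_nat_into (set_pmf p) ` {..n}" for n :: nat
  have "range (from_nat_into (set_pmf p)) = set_pmf p"
    by (intro range_from_nat_into countable_set_pmf set_pmf_not_empty)
  then have U: "(\<Union>n. A n) = set_pmf p"
    unfolding A_def by (auto simp: image_def) blast+
  have "(\<lambda>n. measure_pmf.prob p (A n)) \<longlonglongrightarrow> measure_pmf.prob p (\<Union>n. A n)"
    by (rule measure_pmf.finite_Lim_measure_incseq) (auto simp: A_def incseq_def)
  also have "measure_pmf.prob p (\<Union>n. A n) = 1"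
    unfolding U by (simp add: measure_pmf.prob_eq_1 AE_measure_pmf)
  finally have "eventually (\<lambda>n. measure_pmf.prob p (A n) > 1 - \<epsilon>) sequentially"
    using assms by (intro order_tendstoD) auto
  then obtain n where "measure_pmf.prob p (A n) > 1 - \<epsilon>"
    by (auto simp: eventually_sequentially)
  then show ?thesis
    by (intro that[of "A n"]) (auto simp: A_def)
qed

lemma pmf_le_tv_dist: "\<bar>pmf p x - pmf q x\<bar> \<le> tv_dist p q"
  using tv_dist_upper[of p "{x}" q] by (simp add: measure_pmf_single)

lemma prob_split_finite:
  assumes "finite F"
  shows "measure_pmf.prob p A \<le> sum (pmf p) (A \<inter> F) + measure_pmf.prob p (- F)"
    and "sum (pmf p) (A \<inter> F) \<le> measure_pmf.prob p A"
proof -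
  have "measure_pmf.prob p A \<le> measure_pmf.prob p ((A \<inter> F) \<union> - F)"
    by (intro measure_pmf.finite_measure_mono) auto
  also have "\<dots> \<le> measure_pmf.prob p (A \<inter> F) + measure_pmf.prob p (- F)"
    by (intro measure_Un_le) auto
  also have "measure_pmf.prob p (A \<inter> F) = sum (pmf p) (A \<inter> F)"
    using assms by (simp add: measure_measure_pmf_finite)
  finally show "measure_pmf.prob p A \<le> sum (pmf p) (A \<inter> F) + measure_pmf.prob p (- F)" .
  have "sum (pmf p) (A \<inter> F) = measure_pmf.prob p (A \<inter> F)"
    using assms by (simp add: measure_measure_pmf_finite)
  also have "\<dots> \<le> measure_pmf.prob p A"
    by (intro measure_pmf.finite_measure_mono) auto
  finally show "sum (pmf p) (A \<inter> F) \<le> measure_pmf.prob p A" .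
qed

lemma prob_Compl: "measure_pmf.prob p (- F) = 1 - measure_pmf.prob p F"
  using measure_pmf.prob_compl[of F p] by (simp add: Compl_eq_Diff_UNIV)

text \<open>The masses outside \<open>F\<close> both lie in \<open>[0, \<epsilon>]\<close>, so they
  contribute \<open>\<epsilon>\<close> only once.\<close>

lemma tv_dist_le_finite:
  assumes F: "finite F" and p: "measure_pmf.prob p (- F) \<le> \<epsilon>" and q: "measure_pmf.prob q (- F) \<le> \<epsilon>"
    and pq: "\<And>x. x \<in> F \<Longrightarrow> \<bar>pmf p x - pmf q x\<bar> \<le> \<delta>"
    and \<delta>: "0 \<le> \<delta>"
  shows "tv_dist p q \<le> real (card F) * \<delta> + \<epsilon>"
proof (rule tv_dist_least)
  fix A
  have "\<bar>sum (pmf p) (A \<inter> F) - sum (pmf q) (A \<inter> F)\<bar> \<le> (\<Sum>x\<in>A \<inter> F. \<bar>pmf p x - pmf q x\<bar>)"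
    unfolding sum_subtractf[symmetric] by (rule sum_abs)
  also have "\<dots> \<le> real (card (A \<inter> F)) * \<delta>"
    using pq by (intro sum_bounded_above) auto
  also have "\<dots> \<le> real (card F) * \<delta>"
    using F \<delta> by (intro mult_right_mono) (auto intro!: card_mono)
  finally show "\<bar>measure_pmf.prob p A - measure_pmf.prob q A\<bar> \<le> real (card F) * \<delta> + \<epsilon>"
    using prob_split_finite[OF F, of p A] prob_split_finite[OF F, of q A] p q by linarith
qed

text \<open>The masses of single points converge; a Cauchy sequence is tight, so no mass is lost in
  the pointwise limit \<open>g\<close>, and on a finite set pointwise convergence is
  uniform.\<close>

lemma tv_mcomplete: "Metric_space.mcomplete UNIV (tv_dist :: 'a pmf \<Rightarrow> 'a pmf \<Rightarrow> real)"
  unfolding tv.mcomplete_def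
proof (intro allI impI)
  fix \<sigma> :: "nat \<Rightarrow> 'a pmf"
  assume "tv.MCauchy \<sigma>"
  then have cauchy: "\<exists>n0. \<forall>m\<ge>n0. \<forall>n\<ge>n0. tv_dist (\<sigma> m) (\<sigma> n) < \<epsilon>" if "\<epsilon> > 0" for \<epsilon>
    using \<open>tv.MCauchy \<sigma>\<close> that by (simp add: tv.MCauchy_def)
  have "Cauchy (\<lambda>n. pmf (\<sigma> n) x)" for x
  proof (rule metric_CauchyI)
    fix \<epsilon> :: real assume "\<epsilon> > 0"
    with cauchy obtain n0 where "\<forall>m\<ge>n0. \<forall>n\<ge>n0. tv_dist (\<sigma> m) (\<sigma> n) < \<epsilon>" by blast
    then have "\<forall>m\<ge>n0. \<forall>n\<ge>n0. dist (pmf (\<sigma> m) x) (pmf (\<sigma> n) x) < \<epsilon>"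
      unfolding dist_real_def by (auto intro: le_less_trans[OF pmf_le_tv_dist])
    then show "\<exists>M. \<forall>m\<ge>M. \<forall>n\<ge>M. dist (pmf (\<sigma> m) x) (pmf (\<sigma> n) x) < \<epsilon>" by blast
  qed
  then have "\<exists>l. (\<lambda>n. pmf (\<sigma> n) x) \<longlonglongrightarrow> l" for x
    by (simp add: Cauchy_convergent_iff convergent_def)
  then obtain g where g: "\<And>x. (\<lambda>n. pmf (\<sigma> n) x) \<longlonglongrightarrow> g x"
    by metis
  have g_nonneg: "0 \<le> g x" for x
    using g[of x] by (rule LIMSEQ_le_const) auto
  \<comment> \<open>A finite set that carries most of the mass of one late term carries most of the
    mass of all later terms, which are close to it, and hence of \<open>g\<close>.\<close>
  have tight: "\<exists>F n0. finite F \<and> (\<forall>n\<ge>n0. 1 - \<epsilon> \<le> measure_pmf.prob (\<sigma> n) F) \<and> 1 - \<epsilon> \<le> sum g F"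
    if "\<epsilon> > 0" for \<epsilon>
  proof -
    obtain n0 where n0: "\<forall>m\<ge>n0. \<forall>n\<ge>n0. tv_dist (\<sigma> m) (\<sigma> n) < \<epsilon> / 2"
      using cauchy[of "\<epsilon> / 2"] \<open>\<epsilon> > 0\<close> by auto
    obtain F where F: "finite F" "1 - \<epsilon> / 2 \<le> measure_pmf.prob (\<sigma> n0) F"
      using exists_finite_prob_ge[of "\<epsilon> / 2"] \<open>\<epsilon> > 0\<close> by (metis half_gt_zero)
    have *: "1 - \<epsilon> \<le> measure_pmf.prob (\<sigma> n) F" if "n \<ge> n0" for n
      using n0[rule_format, of n0 n] that F(2) tv_dist_upper[of "\<sigma> n0" F "\<sigma> n"] by simp
    have "(\<lambda>n. sum (pmf (\<sigma> n)) F) \<longlonglongrightarrow> sum g F"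
      by (intro tendsto_sum g)
    moreover have "\<exists>n0. \<forall>n\<ge>n0. 1 - \<epsilon> \<le> sum (pmf (\<sigma> n)) F"
      using * F by (metis measure_measure_pmf_finite)
    ultimately have "1 - \<epsilon> \<le> sum g F"
      by (rule LIMSEQ_le_const)
    with F * show ?thesis by blast
  qed
  \<comment> \<open>Fatou's lemma bounds the total mass from above, tightness from below.\<close>
  have "(\<integral>\<^sup>+ x. ennreal (g x) \<partial>count_space UNIV) = 1"
  proof (rule antisym)
    have "liminf (\<lambda>n. ennreal (pmf (\<sigma> n) x)) = ennreal (g x)" for x
      by (intro lim_imp_Liminf tendsto_ennrealI g) simp
    then have "(\<integral>\<^sup>+ x. ennreal (g x) \<partial>count_space UNIV)
        \<le> liminf (\<lambda>n. \<integral>\<^sup>+ x. ennreal (pmf (\<sigma> n) x) \<partial>count_space UNIV)"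
      using nn_integral_liminf[of "\<lambda>n x. ennreal (pmf (\<sigma> n) x)" "count_space UNIV"] by simp
    also have "\<dots> = 1"
      by (simp add: nn_integral_pmf_eq_1 Liminf_const)
    finally show "(\<integral>\<^sup>+ x. ennreal (g x) \<partial>count_space UNIV) \<le> 1" .
    show "1 \<le> (\<integral>\<^sup>+ x. ennreal (g x) \<partial>count_space UNIV)"
    proof (rule ennreal_le_epsilon)
      fix e :: real assume "e > 0"
      then obtain F where F: "finite F" "1 - e \<le> sum g F"
        using tight by blast
      have "ennreal (sum g F) = (\<integral>\<^sup>+ x. ennreal (g x) \<partial>count_space F)"
        using F g_nonneg by (simp add: nn_integral_count_space_finite)
      also have "\<dots> \<le> (\<integral>\<^sup>+ x. ennreal (g x) \<partial>count_space UNIV)"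
        by (simp add: nn_integral_count_space_indicator) (intro nn_integral_mono, simp add: indicator_def)
      finally have "ennreal (sum g F) + ennreal e \<le> (\<integral>\<^sup>+ x. ennreal (g x) \<partial>count_space UNIV) + ennreal e"
        by (rule add_right_mono)
      moreover have "1 \<le> ennreal (sum g F) + ennreal e"
        using ennreal_leI[of 1 "sum g F + e"] F g_nonneg \<open>e > 0\<close> by (simp add: sum_nonneg)
      ultimately show "1 \<le> (\<integral>\<^sup>+ x. ennreal (g x) \<partial>count_space UNIV) + ennreal e"
        by (rule order_trans[rotated])
    qed
  qed
  then have pmf_g: "pmf (embed_pmf g) x = g x" for x
    using g_nonneg by (simp add: pmf_embed_pmf)
  have "\<exists>n0. \<forall>n\<ge>n0. tv_dist (\<sigma> n) (embed_pmf g) < \<epsilon>" if "\<epsilon> > 0" for \<epsilon>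
  proof -
    obtain F n0 where F: "finite F" "\<forall>n\<ge>n0. 1 - \<epsilon> / 3 \<le> measure_pmf.prob (\<sigma> n) F" "1 - \<epsilon> / 3 \<le> sum g F"
      using tight[of "\<epsilon> / 3"] \<open>\<epsilon> > 0\<close> by auto
    \<comment> \<open>The \<open>+ 1\<close> keeps the denominator positive when \<open>F\<close> is
      empty.\<close>
    define \<delta> where "\<delta> = \<epsilon> / 3 / (real (card F) + 1)"
    have \<delta>: "\<delta> > 0"
      using that by (simp add: \<delta>_def)
    have "real (card F) * \<delta> \<le> \<epsilon> / 3"
      using that by (simp add: \<delta>_def field_simps)
    moreover have "eventually (\<lambda>n. \<forall>x\<in>F. \<bar>pmf (\<sigma> n) x - g x\<bar> < \<delta>) sequentially"
      using F(1) tendstoD[OF g \<delta>] by (simp add: eventually_ball_finite_distrib dist_real_def)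
    then obtain n1 where "\<forall>n\<ge>n1. \<forall>x\<in>F. \<bar>pmf (\<sigma> n) x - g x\<bar> < \<delta>"
      by (auto simp: eventually_sequentially)
    then have "tv_dist (\<sigma> n) (embed_pmf g) \<le> real (card F) * \<delta> + \<epsilon> / 3" if "n \<ge> max n0 n1" for n
      using that F \<delta>
      by (intro tv_dist_le_finite)
         (auto simp: prob_Compl pmf_g measure_measure_pmf_finite less_imp_le)
    ultimately have "tv_dist (\<sigma> n) (embed_pmf g) < \<epsilon>" if "n \<ge> max n0 n1" for n
      using that \<open>\<epsilon> > 0\<close> by force
    then show ?thesis by blast
  qed
  then show "\<exists>q. limitin tv.mtopology \<sigma> q sequentially"
    by (auto simp: tv.limitin_metric eventually_sequentially)
qed

text \<open>Rounding the first \<open>k\<close> masses down to multiples of a small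
  \<open>\<delta>\<close> sorts \<open>S\<close> into finitely many classes. Two members of one
  class differ by at most \<open>k \<delta>\<close> below \<open>k\<close> and by at most
  \<open>\<epsilon> / 3\<close> beyond, so one representative per class suffices.\<close>

lemma tv_mtotally_bounded:
  fixes S :: "nat pmf set"
  assumes tails: "\<And>\<epsilon>. \<epsilon> > 0 \<Longrightarrow> \<exists>k. \<forall>p\<in>S. measure_pmf.prob p {k..} \<le> \<epsilon>"
  shows "tv.mtotally_bounded S"
  unfolding tv.mtotally_bounded_def
proof (intro allI impI)
  fix \<epsilon> :: real assume \<epsilon>: "\<epsilon> > 0"
  obtain k where k: "\<forall>p\<in>S. measure_pmf.prob p {k..} \<le> \<epsilon> / 3"
    using tails[of "\<epsilon> / 3"] \<epsilon> by auto
  define \<delta> where "\<delta> = \<epsilon> / 3 / (real k + 1)"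
  have \<delta>: "\<delta> > 0" "real k * \<delta> \<le> \<epsilon> / 3"
    using \<epsilon> by (auto simp: \<delta>_def field_simps)
  define \<phi> where "\<phi> p = restrict (\<lambda>x. \<lfloor>pmf p x / \<delta>\<rfloor>) {..<k}" for p :: "nat pmf"
  have "\<phi> p \<in> PiE {..<k} (\<lambda>_. {0..\<lfloor>1 / \<delta>\<rfloor>})" for p
    unfolding \<phi>_def restrict_PiE_iff using \<delta>
    by (auto simp: pmf_le_1 intro!: floor_mono divide_right_mono)
  then have "\<phi> ` S \<subseteq> PiE {..<k} (\<lambda>_. {0..\<lfloor>1 / \<delta>\<rfloor>})"
    by blast
  then have "finite (\<phi> ` S)"
    by (rule finite_subset) (auto intro: finite_PiE)
  then obtain K where K: "K \<subseteq> S" "finite K" "\<phi> ` S = \<phi> ` K"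
    using finite_subset_image[of "\<phi> ` S" \<phi> S] by auto
  have "S \<subseteq> (\<Union>q\<in>K. tv.mball q \<epsilon>)"
  proof
    fix p assume p: "p \<in> S"
    then obtain q where q: "q \<in> K" "\<phi> p = \<phi> q"
      using K(3) by (metis imageE image_eqI)
    have "\<bar>pmf q x - pmf p x\<bar> \<le> \<delta>" if "x \<in> {..<k}" for x
    proof -
      have "\<lfloor>pmf p x / \<delta>\<rfloor> = \<lfloor>pmf q x / \<delta>\<rfloor>"
        using fun_cong[OF q(2), of x] that by (simp add: \<phi>_def)
      then have "\<bar>pmf q x / \<delta> - pmf p x / \<delta>\<bar> \<le> 1"
        by linarith
      then show ?thesis
        using \<delta> by (simp add: diff_divide_distrib[symmetric] field_simps)
    qed
    moreover have "- {..<k} = {k..}" by auto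
    ultimately have "tv_dist q p \<le> real (card {..<k}) * \<delta> + \<epsilon> / 3"
      using k p q K \<delta> by (intro tv_dist_le_finite) auto
    then show "p \<in> (\<Union>q\<in>K. tv.mball q \<epsilon>)"
      using q \<delta> \<epsilon> by (auto intro!: bexI[of _ q])
  qed
  with K show "\<exists>K. finite K \<and> K \<subseteq> S \<and> S \<subseteq> (\<Union>q\<in>K. tv.mball q \<epsilon>)"
    by blast
qed

section \<open>Sums over edges, mixtures, expectations and a power series\<close>

lemma infsum_edges_finite:
  fixes h :: "nat \<times> nat \<Rightarrow> real"
  assumes "finite Z" and h: "\<And>z z'. z \<notin> Z \<Longrightarrow> h (z, z') = 0"
  shows "infsum h edges = (\<Sum>z\<in>Z. h (z, z + 1) + (if z = 0 then 0 else h (z, 0)))"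
proof -
  let ?U = "(\<lambda>z. (z, z + 1)) ` Z" and ?D = "(\<lambda>z. (z, 0)) ` (Z - {0})"
  have "infsum h edges = infsum h (?U \<union> ?D)"
    by (rule infsum_cong_neutral) (auto simp: edges_def image_iff intro: h)
  also have "\<dots> = sum h ?U + sum h ?D"
    using assms by (subst infsum_finite) (auto intro!: sum.union_disjoint)
  also have "sum h ?U = (\<Sum>z\<in>Z. h (z, z + 1))"
    by (subst sum.reindex) (auto simp: inj_on_def)
  also have "sum h ?D = (\<Sum>z\<in>Z - {0}. h (z, 0))"
    by (subst sum.reindex) (auto simp: inj_on_def)
  also have "\<dots> = (\<Sum>z\<in>Z. if z = 0 then 0 else h (z, 0))"
    using assms by (intro sum.mono_neutral_cong_left) auto
  finally show ?thesis
    by (simp add: sum.distrib)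
qed

lemma expectation_bind_bernoulli:
  fixes f :: "'a \<Rightarrow> real"
  assumes "0 \<le> r" "r \<le> 1" "\<And>b. finite (set_pmf (h b))"
  shows "measure_pmf.expectation (bind_pmf (bernoulli_pmf r) h) f
    = r * measure_pmf.expectation (h True) f + (1 - r) * measure_pmf.expectation (h False) f"
  using assms by (subst pmf_expectation_bind[of UNIV]) (auto simp: UNIV_bool)

lemma pmf_bind_ge: "pmf p x * pmf (Q x) y \<le> pmf (bind_pmf p Q) y"
proof -
  have "pmf p x * pmf (Q x) y = measure_pmf.expectation p (\<lambda>a. indicator {x} a * pmf (Q x) y)"
    by (simp add: measure_pmf_single)
  also have "\<dots> \<le> measure_pmf.expectation p (\<lambda>a. pmf (Q a) y)"
    by (intro integral_mono integrable_pmf_bounded[where C = 1])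
       (auto simp: indicator_def pmf_le_1)
  finally show ?thesis
    by (simp add: pmf_bind)
qed

lemma expectation_bind_pmf_bounded:
  fixes f :: "'b \<Rightarrow> real"
  assumes "\<And>y. \<bar>f y\<bar> \<le> C"
  shows "measure_pmf.expectation (bind_pmf p Q) f = measure_pmf.expectation p (\<lambda>x. measure_pmf.expectation (Q x) f)"
  unfolding measure_pmf_bind using assms
  by (subst integral_bind[where K = "count_space UNIV" and B' = 1 and B = C])
     (auto simp: measure_pmf.emeasure_space_1 measure_pmf_in_subprob_space)

lemma empirical_measures_eq: "empirical_measures N = pmf_of_multiset ` {M. size M = N}"
  unfolding empirical_measures_def by (auto simp: image_iff) (metis ex_mset size_mset)

lemma sum_image_mset_count:
  fixes g :: "'a \<Rightarrow> 'b::comm_semiring_1"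
  shows "(\<Sum>x\<in>#M. g x) = (\<Sum>x\<in>set_mset M. of_nat (count M x) * g x)"
proof -
  have "(\<Sum>x\<in>#M. g x) = (\<Sum>x\<in>A. of_nat (count M x) * g x)" if "finite A" "set_mset M \<subseteq> A" for A
    using that
  proof (induction M)
    case (add y M)
    have "(\<Sum>x\<in>A. of_nat (count (add_mset y M) x) * g x)
        = (\<Sum>x\<in>A. (if y = x then g x else 0) + of_nat (count M x) * g x)"
      by (intro sum.cong) (auto simp: algebra_simps)
    then show ?case
      using add by (simp add: sum.distrib)
  qed simp
  then show ?thesis by simp
qed

lemma abs_expectation_le:
  fixes f :: "'a \<Rightarrow> real"
  assumes "\<And>x. x \<in> set_pmf p \<Longrightarrow> \<bar>f x\<bar> \<le> B"
  shows "\<bar>measure_pmf.expectation p f\<bar> \<le> B"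
proof -
  have i: "integrable (measure_pmf p) f"
    using assms by (rule integrable_pmf_bounded)
  have "measure_pmf.expectation p f \<le> B" "-B \<le> measure_pmf.expectation p f"
    using assms i by (auto intro!: measure_pmf.integral_le_const measure_pmf.integral_ge_const
        simp: AE_measure_pmf_iff abs_le_iff) (smt (verit))+
  then show ?thesis by simp
qed

lemma expectation_cong_pmf:
  fixes f g :: "'a \<Rightarrow> real"
  assumes "\<And>x. x \<in> set_pmf p \<Longrightarrow> f x = g x"
  shows "measure_pmf.expectation p f = measure_pmf.expectation p g"
  using assms by (intro integral_cong_AE) (auto simp: AE_measure_pmf_iff)

text \<open>Allows differentiating the invariance identity at time 0, where only
  \<open>t \<ge> 0\<close> is available: divide the vanishing remainder by \<open>t > 0\<close> and
  let \<open>t\<close> decrease to 0.\<close>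

lemma powser_coeff_1_eq_0:
  fixes c :: "nat \<Rightarrow> real"
  assumes "\<And>t. 0 \<le> t \<Longrightarrow> (\<lambda>n. c n * t ^ n) sums c 0"
  shows "c 1 = 0"
proof -
  define h where "h t = (\<Sum>n. c (Suc n) * t ^ n)" for t
  have *: "(\<lambda>n. c (Suc n) * t ^ n) sums 0" if "t > 0" for t
  proof -
    have "(\<lambda>n. c (Suc n) * t ^ Suc n) sums (c 0 - c 0 * t ^ 0)"
      using assms[of t] that by (subst sums_Suc_iff) simp
    then have "(\<lambda>n. t * (c (Suc n) * t ^ n)) sums (t * 0)"
      by (simp add: algebra_simps)
    then show ?thesis
      using that by (subst (asm) sums_mult_iff) auto
  qed
  have "summable (\<lambda>n. c (Suc n) * t ^ n)" if "norm t < 1" for t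
    by (rule powser_inside[of _ 1]) (use *[of 1] that in \<open>auto simp: sums_iff\<close>)
  then have "(h \<longlongrightarrow> c (Suc 0)) (at 0)"
    by (intro powser_limit_0[of 1 "\<lambda>n. c (Suc n)" h]) (auto simp: h_def summable_sums)
  then have "(h \<longlongrightarrow> c (Suc 0)) (at_right 0)"
    by (rule tendsto_mono[rotated]) (simp add: at_le)
  moreover have "(h \<longlongrightarrow> 0) (at_right 0)"
    using * by (intro tendsto_eventually) (auto simp: h_def sums_iff eventually_at_filter)
  ultimately show ?thesis
    by (simp add: tendsto_unique[OF trivial_limit_at_right_real])
qed

section \<open>The uniformized chain\<close>

locale mean_field =
  fixes N :: nat and lam :: "nat \<Rightarrow> nat \<Rightarrow> nat pmf \<Rightarrow> real" and ll lu :: real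
  assumes N: "1 \<le> N"
    and ll_pos: "0 < ll"
    and up: "\<And>z \<xi>. 0 \<le> lam z (z + 1) \<xi>" "\<And>z \<xi>. lam z (z + 1) \<xi> \<le> lu / (real z + 1)"
    and down: "\<And>z \<xi>. z \<noteq> 0 \<Longrightarrow> ll \<le> lam z 0 \<xi>" "\<And>z \<xi>. z \<noteq> 0 \<Longrightarrow> lam z 0 \<xi> \<le> lu"
begin

section \<open>The generator as a sum over particles\<close>

abbreviation S where "S \<equiv> empirical_measures N"

definition emp :: "nat multiset \<Rightarrow> nat pmf" where
  "emp = pmf_of_multiset"

lemma S_eq: "S = emp ` {M. size M = N}"
  by (simp add: empirical_measures_eq emp_def)

lemma ll_le_lu: "ll \<le> lu"
  using down[of 1] by (meson one_neq_zero order_trans)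

lemma lu_pos: "0 < lu"
  using ll_pos ll_le_lu by simp

lemma nonempty: "size M = N \<Longrightarrow> M \<noteq> {#}"
  using N by auto

lemma pmf_emp: "size M = N \<Longrightarrow> pmf (emp M) z = count M z / N"
  by (simp add: emp_def nonempty)

lemma set_emp: "size M = N \<Longrightarrow> set_pmf (emp M) = set_mset M"
  by (simp add: emp_def nonempty set_pmf_of_multiset)

lemma jump_emp: "size M = N \<Longrightarrow> z \<in># M \<Longrightarrow> jump N z z' (emp M) = emp (add_mset z' (M - {#z#}))"
  by (simp add: emp_def jump_pmf_of_multiset)

lemma emp_in_S [intro]: "size M = N \<Longrightarrow> emp M \<in> S"
  by (auto simp: S_eq)

lemma jump_in_S: "size M = N \<Longrightarrow> z \<in># M \<Longrightarrow> jump N z z' (emp M) \<in> S"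
  using N by (simp add: jump_emp emp_in_S size_Suc_Diff1)

text \<open>The contribution of a single particle at \<open>z\<close>; counted with multiplicity,
  these add up to the generator.\<close>

definition drift :: "(nat pmf \<Rightarrow> real) \<Rightarrow> nat pmf \<Rightarrow> nat \<Rightarrow> real" where
  "drift f \<xi> z = lam z (z + 1) \<xi> * (f (jump N z (z + 1) \<xi>) - f \<xi>)
     + (if z = 0 then 0 else lam z 0 \<xi> * (f (jump N z 0 \<xi>) - f \<xi>))"

lemma generator_emp:
  assumes M: "size M = N"
  shows "generator N lam f (emp M) = (\<Sum>z\<in>#M. drift f (emp M) z)"
proof -
  have "generator N lam f (emp M) = (\<Sum>z\<in>set_mset M. real (count M z) * drift f (emp M) z)"
    unfolding generator_def
    by (subst infsum_edges_finite[of "set_mset M"])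
       (use M N in \<open>auto simp: pmf_emp drift_def algebra_simps not_in_iff intro!: sum.cong\<close>)
  then show ?thesis
    by (simp add: sum_image_mset_count)
qed

text \<open>Only \<open>z = z' = 0\<close> is not an edge.\<close>

definition accept :: "nat \<Rightarrow> nat \<Rightarrow> nat pmf \<Rightarrow> real" where
  "accept z z' \<xi> = (if z = z' then 0 else lam z z' \<xi> / lu)"

lemma accept_bounds: "z' \<in> {z + 1, 0} \<Longrightarrow> 0 \<le> accept z z' \<xi>" "z' \<in> {z + 1, 0} \<Longrightarrow> accept z z' \<xi> \<le> 1"
proof -
  have "lam z (z + 1) \<xi> \<le> lu"
    using up(2)[of z \<xi>] lu_pos by (smt (verit) divide_le_eq_1 frac_le of_nat_0_le_iff div_by_1)
  then show "z' \<in> {z + 1, 0} \<Longrightarrow> accept z z' \<xi> \<le> 1"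
    using lu_pos down(2)[of z \<xi>] by (auto simp: accept_def)
  show "z' \<in> {z + 1, 0} \<Longrightarrow> 0 \<le> accept z z' \<xi>"
    using lu_pos up(1)[of z \<xi>] down(1)[of z \<xi>] ll_pos by (auto simp: accept_def)
qed

definition try_jump :: "nat pmf \<Rightarrow> nat \<Rightarrow> nat \<Rightarrow> nat pmf pmf" where
  "try_jump \<xi> z z' = bind_pmf (bernoulli_pmf (accept z z' \<xi>))
     (\<lambda>b. return_pmf (if b then jump N z z' \<xi> else \<xi>))"

definition move :: "nat pmf \<Rightarrow> nat \<Rightarrow> nat pmf pmf" where
  "move \<xi> z = bind_pmf (bernoulli_pmf (1 / 2)) (\<lambda>b. try_jump \<xi> z (if b then z + 1 else 0))"

definition ground :: "nat pmf" where
  "ground = emp (replicate_mset N 0)"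

text \<open>One step of the uniformized chain: a uniformly chosen particle proposes one of its two jumps
  with probability \<open>1/2\<close> each. The value outside \<^term>\<open>S\<close> is chosen so that the Doeblin bound
  holds from every starting point.\<close>

definition kernel :: "nat pmf \<Rightarrow> nat pmf pmf" where
  "kernel \<xi> = (if \<xi> \<in> S then bind_pmf \<xi> (move \<xi>) else return_pmf ground)"

lemma ground_in_S: "ground \<in> S"
  by (auto simp: ground_def)

section \<open>One step of the chain\<close>

lemma expectation_try_jump:
  assumes "z' \<in> {z + 1, 0}"
  shows "measure_pmf.expectation (try_jump \<xi> z z') f = f \<xi> + accept z z' \<xi> * (f (jump N z z' \<xi>) - f \<xi>)"
  unfolding try_jump_def using assms
  by (subst expectation_bind_bernoulli) (auto simp: accept_bounds algebra_simps)

lemma finite_set_try_jump: "finite (set_pmf (try_jump \<xi> z z'))"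
  by (auto simp: try_jump_def)

lemma finite_set_move: "finite (set_pmf (move \<xi> z))"
  by (auto simp: move_def finite_set_try_jump)

lemma expectation_move:
  "measure_pmf.expectation (move \<xi> z) f = f \<xi> + drift f \<xi> z / (2 * lu)"
  unfolding move_def using lu_pos
  by (subst expectation_bind_bernoulli)
     (auto simp: finite_set_try_jump expectation_try_jump[simplified] drift_def accept_def field_simps)

text \<open>The scale \<open>2 * lu * N\<close> collects the choice of a particle
  (\<open>1 / N\<close>), the choice of a direction (\<open>1 / 2\<close>) and the acceptance
  probability (rate divided by \<open>lu\<close>).\<close>

lemma expectation_kernel:
  assumes "\<xi> \<in> S"
  shows "measure_pmf.expectation (kernel \<xi>) f = f \<xi> + generator N lam f \<xi> / (2 * lu * N)"
proof -
  obtain M where M: "size M = N" "\<xi> = emp M"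
    using assms by (auto simp: S_eq)
  have "measure_pmf.expectation (kernel \<xi>) f
      = (\<Sum>z\<in>set_mset M. pmf \<xi> z * (f \<xi> + drift f \<xi> z / (2 * lu)))"
    using assms M unfolding kernel_def
    by (simp, subst pmf_expectation_bind[of "set_mset M"]) (auto simp: finite_set_move set_emp expectation_move)
  also have "\<dots> = (\<Sum>z\<in>set_mset M. pmf \<xi> z) * f \<xi> + (\<Sum>z\<in>set_mset M. real (count M z) * drift f \<xi> z) / (2 * lu * N)"
    using M N by (simp add: algebra_simps sum.distrib sum_distrib_left sum_divide_distrib pmf_emp)
  also have "(\<Sum>z\<in>set_mset M. pmf \<xi> z) = 1"
    using M by (intro sum_pmf_eq_1) (auto simp: set_emp)
  also have "(\<Sum>z\<in>set_mset M. real (count M z) * drift f \<xi> z) = generator N lam f \<xi>"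
    using M by (simp add: generator_emp sum_image_mset_count)
  finally show ?thesis by simp
qed

lemma set_kernel_subset: "set_pmf (kernel \<xi>) \<subseteq> S"
proof (cases "\<xi> \<in> S")
  case True
  then obtain M where M: "size M = N" "\<xi> = emp M"
    by (auto simp: S_eq)
  have "set_pmf (move \<xi> z) \<subseteq> S" if "z \<in># M" for z
    using that True M(2) by (auto simp: move_def try_jump_def jump_in_S[OF M(1)] split: if_splits)
  then show ?thesis
    using True M by (auto simp: kernel_def set_emp)
qed (auto simp: kernel_def ground_in_S)

text \<open>A lower bound for choosing an occupied excited state (at least \<open>1 / N\<close>),
  proposing the jump to 0 (\<open>1 / 2\<close>) and accepting it (at least
  \<open>ll / lu\<close>).\<close>

definition down_prob :: real where
  "down_prob = ll / (2 * lu * N)"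

lemma down_prob_bounds: "0 < down_prob" "down_prob \<le> 1 / 2"
proof -
  show "0 < down_prob"
    using ll_pos lu_pos N by (simp add: down_prob_def)
  have "ll * 1 \<le> lu * N"
    using ll_le_lu ll_pos lu_pos N by (intro mult_mono) auto
  then show "down_prob \<le> 1 / 2"
    using lu_pos N by (simp add: down_prob_def field_simps)
qed

text \<open>Treats two situations at once: a particle with \<open>z \<noteq> 0\<close> proposes 0
  and is accepted (\<open>b\<close> true), or a particle at 0 proposes the non-edge from 0 to 0,
  which is always rejected (\<open>b\<close> false).\<close>

lemma move_down_ge:
  assumes "b \<longleftrightarrow> z \<noteq> 0"
  shows "1 / 2 * pmf (bernoulli_pmf (accept z 0 \<xi>)) b \<le> pmf (move \<xi> z) (if b then jump N z 0 \<xi> else \<xi>)"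
proof -
  have "1 / 2 * (pmf (bernoulli_pmf (accept z 0 \<xi>)) b * 1)
      \<le> pmf (bernoulli_pmf (1 / 2)) False * pmf (try_jump \<xi> z 0) (if b then jump N z 0 \<xi> else \<xi>)"
    unfolding try_jump_def
    using pmf_bind_ge[of "bernoulli_pmf (accept z 0 \<xi>)" b "\<lambda>b. return_pmf (if b then jump N z 0 \<xi> else \<xi>)"
      "if b then jump N z 0 \<xi> else \<xi>"]
    by simp
  also have "\<dots> \<le> pmf (move \<xi> z) (if b then jump N z 0 \<xi> else \<xi>)"
    unfolding move_def
    using pmf_bind_ge[of "bernoulli_pmf (1 / 2)" False "\<lambda>b. try_jump \<xi> z (if b then z + 1 else 0)"]
    by simp
  finally show ?thesis by simp
qed

lemma kernel_down_ge:
  assumes M: "size M = N" and z: "z \<in># M" "z \<noteq> 0"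
  shows "down_prob \<le> pmf (kernel (emp M)) (emp (add_mset 0 (M - {#z#})))"
proof -
  have acc: "ll / lu \<le> accept z 0 (emp M)"
    using z down(1)[of z] lu_pos by (simp add: accept_def divide_right_mono)
  have "down_prob = 1 / N * (1 / 2 * (ll / lu))"
    by (simp add: down_prob_def)
  also have "\<dots> \<le> pmf (emp M) z * (1 / 2 * accept z 0 (emp M))"
    using acc M z N ll_pos lu_pos by (intro mult_mono) (auto simp: pmf_emp divide_right_mono)
  also have "\<dots> \<le> pmf (emp M) z * pmf (move (emp M) z) (jump N z 0 (emp M))"
    using move_down_ge[of True z "emp M"] z accept_bounds[of 0 z "emp M"]
    by (intro mult_left_mono) auto
  also have "\<dots> \<le> pmf (kernel (emp M)) (jump N z 0 (emp M))"
    using M by (simp add: kernel_def emp_in_S pmf_bind_ge)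
  finally show ?thesis
    using M z by (simp add: jump_emp)
qed

text \<open>The rejected proposal from 0 to 0 makes the chain lazy at \<open>ground\<close>, so that
  a path arriving early can wait there.\<close>

lemma kernel_ground_ge: "down_prob \<le> pmf (kernel ground) ground"
proof -
  have "pmf ground 0 = 1"
    unfolding ground_def using N by (simp add: pmf_emp)
  moreover have "1 / 2 \<le> pmf (move ground 0) ground"
    using move_down_ge[of False 0 ground] by (simp add: accept_def)
  moreover have "pmf ground 0 * pmf (move ground 0) ground \<le> pmf (kernel ground) ground"
    by (simp add: kernel_def ground_in_S pmf_bind_ge)
  ultimately show ?thesis
    using down_prob_bounds by simp
qed

section \<open>Minorization of the N-step chain and its stationary measure\<close>

primrec kernel_pow :: "nat \<Rightarrow> nat pmf \<Rightarrow> nat pmf pmf" where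
  "kernel_pow 0 \<xi> = return_pmf \<xi>"
| "kernel_pow (Suc n) \<xi> = bind_pmf (kernel \<xi>) (kernel_pow n)"

lemma bind_kernel_pow: "bind_pmf \<mu> (kernel_pow n) = ((\<lambda>\<mu>. bind_pmf \<mu> kernel) ^^ n) \<mu>"
proof (induction n arbitrary: \<mu>)
  case 0
  have "kernel_pow 0 = return_pmf" by (auto simp: fun_eq_iff)
  then show ?case by (simp add: bind_return_pmf')
next
  case (Suc n)
  have "kernel_pow (Suc n) = (\<lambda>\<xi>. bind_pmf (kernel \<xi>) (kernel_pow n))" by (auto simp: fun_eq_iff)
  then show ?case
    by (simp add: funpow_Suc_right Suc.IH[symmetric] bind_assoc_pmf del: funpow.simps)
qed

lemma no_excited: "filter_mset (\<lambda>z. 0 < z) (replicate_mset k (0::nat)) = {#}"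
  by (rule multiset_eqI) simp

text \<open>Each step either sends one excited particle to 0 or, when none is left, waits at
  \<open>ground\<close>; both have probability at least \<open>down_prob\<close>.\<close>

lemma kernel_pow_ge:
  assumes "size M = N" "size (filter_mset (\<lambda>z. z \<noteq> 0) M) \<le> n"
  shows "down_prob ^ n \<le> pmf (kernel_pow n (emp M)) ground"
  using assms
proof (induction n arbitrary: M)
  case 0
  then have "\<forall>z\<in>#M. z = 0"
    using set_mset_filter[of "\<lambda>z. z \<noteq> 0" M] by auto
  then have "M = replicate_mset N 0"
    using 0 by (metis set_mset_subset_singletonD subsetI singletonI)
  then show ?case by (simp add: ground_def)
next
  case (Suc n)
  have step: "down_prob ^ Suc n \<le> pmf (kernel_pow (Suc n) (emp M)) ground"
    if "size M' = N" "size (filter_mset (\<lambda>z. z \<noteq> 0) M') \<le> n" "down_prob \<le> pmf (kernel (emp M)) (emp M')" for M'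
  proof -
    have "down_prob ^ Suc n \<le> pmf (kernel (emp M)) (emp M') * pmf (kernel_pow n (emp M')) ground"
      using that Suc.IH[of M'] down_prob_bounds by (simp add: mult_mono)
    also have "\<dots> \<le> pmf (kernel_pow (Suc n) (emp M)) ground"
      by (simp add: pmf_bind_ge)
    finally show ?thesis .
  qed
  show ?case
  proof (cases "\<exists>z. z \<in># M \<and> z \<noteq> 0")
    case True
    then obtain z where z: "z \<in># M" "z \<noteq> 0" by blast
    show ?thesis
    proof (rule step)
      show "down_prob \<le> pmf (kernel (emp M)) (emp (add_mset 0 (M - {#z#})))"
        using Suc.prems z by (intro kernel_down_ge)
      show "size (add_mset 0 (M - {#z#})) = N"
        using Suc.prems z N by (simp add: size_Diff_singleton)
      show "size (filter_mset (\<lambda>z. z \<noteq> 0) (add_mset 0 (M - {#z#}))) \<le> n"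
        using Suc.prems z by (simp add: size_Diff_singleton)
    qed
  next
    case False
    then have "M = replicate_mset N 0"
      using Suc.prems by (metis set_mset_subset_singletonD subsetI singletonI)
    then show ?thesis
      using kernel_ground_ge Suc.prems by (intro step[of M]) (auto simp: ground_def no_excited)
  qed
qed

text \<open>At most \<open>N\<close> particles are excited, so \<open>N\<close> steps suffice. From
  outside \<open>S\<close> the first step goes to \<open>ground\<close> and the other
  \<open>N - 1\<close> steps are spent there.\<close>

lemma kernel_pow_N_ge: "down_prob ^ N \<le> pmf (kernel_pow N \<xi>) ground"
proof (cases "\<xi> \<in> S")
  case True
  then obtain M where "size M = N" "\<xi> = emp M" by (auto simp: S_eq)
  then show ?thesis
    using kernel_pow_ge[of M N] size_filter_mset_lesseq[of _ M] by simp
next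
  case False
  obtain n where n: "N = Suc n"
    using N by (cases N) auto
  have "down_prob ^ N \<le> down_prob ^ n"
    using power_decreasing[of n N down_prob] down_prob_bounds n by simp
  also have "\<dots> \<le> pmf (kernel_pow n ground) ground"
    using kernel_pow_ge[of "replicate_mset N 0" n] no_excited[of N]
    by (simp add: ground_def)
  also have "\<dots> = pmf (kernel_pow N \<xi>) ground"
    using False kernel_pow.simps(2)[of n \<xi>] unfolding n[symmetric] by (simp add: kernel_def bind_return_pmf)
  finally show ?thesis .
qed

lemma stationary_ex1: "\<exists>!\<mu>. bind_pmf \<mu> kernel = \<mu>"
proof -
  let ?T = "\<lambda>\<mu>. bind_pmf \<mu> kernel" and ?F = "\<lambda>\<mu>. bind_pmf \<mu> (kernel_pow N)"
  have F: "?F = ?T ^^ N"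
    by (simp add: bind_kernel_pow fun_eq_iff)
  have lt: "1 - down_prob ^ N < 1"
    using down_prob_bounds by simp
  have contr: "tv_dist (?F \<mu>) (?F \<nu>) \<le> (1 - down_prob ^ N) * tv_dist \<mu> \<nu>" for \<mu> \<nu>
    by (rule tv_dist_bind_minorized[OF kernel_pow_N_ge])
  obtain \<mu> where \<mu>: "?F \<mu> = \<mu>"
    by (rule tv.Banach_fixedpoint_thm[OF tv_mcomplete _ _ lt, of ?F]) (auto intro: contr)
  have unique: "\<nu> = \<mu>" if "?F \<nu> = \<nu>" for \<nu>
  proof -
    have "down_prob ^ N * tv_dist \<nu> \<mu> \<le> 0"
      using contr[of \<nu> \<mu>] that \<mu> by (simp add: algebra_simps)
    then have "tv_dist \<nu> \<mu> \<le> 0"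
      using zero_less_power[OF down_prob_bounds(1), of N] by (simp add: mult_le_0_iff)
    then show ?thesis
      using tv.nonneg[of \<nu> \<mu>] tv.zero[of \<nu> \<mu>] by simp
  qed
  \<comment> \<open>\<open>?F\<close> is a power of \<open>?T\<close> and commutes with it, so
    \<open>?T \<mu>\<close> is again a fixed point of \<open>?F\<close>; uniqueness turns the N-step
    fixed point into a one-step one.\<close>
  have "?F (?T \<mu>) = ?T (?F \<mu>)"
    using fun_cong[OF F, of "?T \<mu>"] fun_cong[OF F, of \<mu>] funpow_swap1[of ?T N \<mu>] by simp
  then have "?T \<mu> = \<mu>"
    using \<mu> by (intro unique) simp
  moreover have "\<nu> = \<mu>" if "?T \<nu> = \<nu>" for \<nu>
  proof (rule unique)
    have "(?T ^^ n) \<nu> = \<nu>" for n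
      by (induction n) (auto simp: that)
    then show "?F \<nu> = \<nu>"
      by (simp add: bind_kernel_pow)
  qed
  ultimately show ?thesis by blast
qed

end

section \<open>Invariance as stationarity\<close>

context mean_field
begin

lemma generator_eq:
  "\<xi> \<in> S \<Longrightarrow> generator N lam f \<xi> = 2 * lu * N * (measure_pmf.expectation (kernel \<xi>) f - f \<xi>)"
  using expectation_kernel[of \<xi> f] lu_pos N by simp

text \<open>On \<open>S\<close> the generator is \<open>2 * lu * N\<close> times the kernel minus
  the identity, and that difference has sup norm at most 2. The kernel never leaves
  \<open>S\<close>, so the bound iterates.\<close>

lemma generator_pow_bound:
  assumes "\<And>\<xi>. \<xi> \<in> S \<Longrightarrow> \<bar>f \<xi>\<bar> \<le> B" "\<xi> \<in> S"
  shows "\<bar>(generator N lam ^^ n) f \<xi>\<bar> \<le> (4 * lu * N) ^ n * B"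
  using assms(2)
proof (induction n arbitrary: \<xi>)
  case (Suc n)
  let ?g = "(generator N lam ^^ n) f"
  have "\<bar>measure_pmf.expectation (kernel \<xi>) ?g\<bar> \<le> (4 * lu * N) ^ n * B"
    using set_kernel_subset Suc.IH by (intro abs_expectation_le) blast
  then have "\<bar>measure_pmf.expectation (kernel \<xi>) ?g - ?g \<xi>\<bar> \<le> 2 * ((4 * lu * N) ^ n * B)"
    using Suc.IH[OF Suc.prems] by linarith
  then have "2 * lu * N * \<bar>measure_pmf.expectation (kernel \<xi>) ?g - ?g \<xi>\<bar> \<le> 2 * lu * N * (2 * ((4 * lu * N) ^ n * B))"
    using lu_pos by (intro mult_left_mono) auto
  also have "\<dots> = (4 * lu * N) ^ Suc n * B"
    by simp
  finally show ?case
    using lu_pos by (simp only: funpow.simps comp_apply generator_eq[OF Suc.prems] abs_mult)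
qed (simp add: assms(1))

lemma bounded_on_S:
  assumes "bounded (f ` S)"
  obtains B :: real where "\<And>\<xi>. \<xi> \<in> S \<Longrightarrow> \<bar>f \<xi>\<bar> \<le> B" "0 \<le> B"
  using assms ground_in_S by (auto simp: bounded_iff) (smt (verit))

text \<open>On \<open>S\<close> the series is dominated by the exponential series at
  \<open>4 * lu * N * t\<close>, so expectation and sum may be exchanged; the result is a power
  series in \<open>t\<close>.\<close>

lemma expectation_transition_semigroup:
  assumes f: "bounded (f ` S)" and \<mu>: "set_pmf \<mu> \<subseteq> S" and t: "0 \<le> t"
  shows "(\<lambda>n. measure_pmf.expectation \<mu> ((generator N lam ^^ n) f) / fact n * t ^ n)
    sums measure_pmf.expectation \<mu> (transition_semigroup N lam t f)"
proof -
  obtain B where B: "\<And>\<xi>. \<xi> \<in> S \<Longrightarrow> \<bar>f \<xi>\<bar> \<le> B" "0 \<le> B"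
    using bounded_on_S[OF f] by blast
  let ?h = "\<lambda>n \<xi>. t ^ n / fact n * (generator N lam ^^ n) f \<xi>"
  let ?b = "\<lambda>n. (4 * lu * N * t) ^ n / fact n * B"
  have bound: "\<bar>?h n \<xi>\<bar> \<le> ?b n" if "\<xi> \<in> S" for n \<xi>
  proof -
    have "\<bar>?h n \<xi>\<bar> = t ^ n / fact n * \<bar>(generator N lam ^^ n) f \<xi>\<bar>"
      using t by (simp add: abs_mult)
    also have "\<dots> \<le> t ^ n / fact n * ((4 * lu * N) ^ n * B)"
      using t B that by (intro mult_left_mono generator_pow_bound) auto
    finally show ?thesis
      by (simp add: power_mult_distrib algebra_simps)
  qed
  have b: "summable ?b"
    using summable_exp[of "4 * lu * N * t"]
    by (intro summable_mult2) (simp add: field_simps)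
  have int: "integrable (measure_pmf \<mu>) (?h n)" for n
    using bound \<mu> by (intro integrable_pmf_bounded[of \<mu> "?h n" "?b n"]) blast
  have sm: "summable (\<lambda>n. norm (?h n \<xi>))" if "\<xi> \<in> S" for \<xi>
    using bound that by (intro summable_comparison_test'[OF b, of 0]) simp
  have "(\<lambda>n. measure_pmf.expectation \<mu> (?h n)) sums measure_pmf.expectation \<mu> (\<lambda>\<xi>. \<Sum>n. ?h n \<xi>)"
  proof (rule sums_integral[OF int])
    show "AE \<xi> in measure_pmf \<mu>. summable (\<lambda>n. norm (?h n \<xi>))"
      using sm \<mu> by (auto simp: AE_measure_pmf_iff)
    show "summable (\<lambda>n. measure_pmf.expectation \<mu> (\<lambda>\<xi>. norm (?h n \<xi>)))"
    proof (rule summable_comparison_test'[OF b, of 0])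
      fix n
      have "\<bar>measure_pmf.expectation \<mu> (\<lambda>\<xi>. norm (?h n \<xi>))\<bar> \<le> ?b n"
        using bound \<mu> by (intro abs_expectation_le) (simp, blast)
      then show "norm (measure_pmf.expectation \<mu> (\<lambda>\<xi>. norm (?h n \<xi>))) \<le> ?b n"
        by simp
    qed
  qed
  then show ?thesis
    unfolding transition_semigroup_def[abs_def] by (simp add: algebra_simps)
qed

text \<open>Invariance makes the power series of expectations constant in \<open>t\<close>, so its
  linear coefficient vanishes. Conversely, each higher power applies the generator to a bounded
  function, so every coefficient beyond the constant one vanishes.\<close>

lemma invariant_measure_iff_generator:
  "invariant_measure N lam \<mu> \<longleftrightarrow> set_pmf \<mu> \<subseteq> S \<and>
     (\<forall>f. bounded (f ` S) \<longrightarrow> measure_pmf.expectation \<mu> (generator N lam f) = 0)"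
proof (intro iffI conjI allI impI)
  assume inv: "invariant_measure N lam \<mu>"
  then show \<mu>: "set_pmf \<mu> \<subseteq> S"
    by (simp add: invariant_measure_def)
  fix f :: "nat pmf \<Rightarrow> real" assume f: "bounded (f ` S)"
  let ?c = "\<lambda>n. measure_pmf.expectation \<mu> ((generator N lam ^^ n) f) / fact n"
  have "(\<lambda>n. ?c n * t ^ n) sums ?c 0" if "0 \<le> t" for t
    using expectation_transition_semigroup[OF f \<mu> that] inv f that
    by (simp add: invariant_measure_def)
  then have "?c 1 = 0"
    by (rule powser_coeff_1_eq_0)
  then show "measure_pmf.expectation \<mu> (generator N lam f) = 0"
    by simp
next
  assume *: "set_pmf \<mu> \<subseteq> S \<and> (\<forall>f. bounded (f ` S) \<longrightarrow> measure_pmf.expectation \<mu> (generator N lam f) = 0)"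
  show "invariant_measure N lam \<mu>"
    unfolding invariant_measure_def
  proof (intro conjI allI impI)
    show "set_pmf \<mu> \<subseteq> S" using * by blast
    fix f :: "nat pmf \<Rightarrow> real" and t :: real
    assume "bounded (f ` S) \<and> 0 \<le> t"
    then have f: "bounded (f ` S)" and t: "0 \<le> t" by auto
    let ?c = "\<lambda>n. measure_pmf.expectation \<mu> ((generator N lam ^^ n) f) / fact n"
    obtain B where B: "\<And>\<xi>. \<xi> \<in> S \<Longrightarrow> \<bar>f \<xi>\<bar> \<le> B"
      using bounded_on_S[OF f] by blast
    have "bounded ((generator N lam ^^ n) f ` S)" for n
      using generator_pow_bound[OF B] by (auto simp: bounded_iff intro!: exI[of _ "(4 * lu * N) ^ n * B"])
    then have "?c (Suc n) = 0" for n
      using * by simp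
    then have "(\<lambda>n. ?c n * t ^ n) sums (\<Sum>n\<in>{0}. ?c n * t ^ n)"
      by (intro sums_finite) (auto elim: not0_implies_Suc simp: gr0_conv_Suc)
    then have "(\<lambda>n. ?c n * t ^ n) sums measure_pmf.expectation \<mu> f"
      by simp
    then show "measure_pmf.expectation \<mu> (transition_semigroup N lam t f) = measure_pmf.expectation \<mu> f"
      using expectation_transition_semigroup[OF f _ t, of \<mu>] * sums_unique2 by blast
  qed
qed

lemma expectation_generator:
  assumes \<mu>: "set_pmf \<mu> \<subseteq> S" and f: "bounded (f ` S)"
  shows "measure_pmf.expectation \<mu> (generator N lam f)
    = 2 * lu * N * (measure_pmf.expectation (bind_pmf \<mu> kernel) f - measure_pmf.expectation \<mu> f)"
proof -
  obtain B where B: "\<And>\<xi>. \<xi> \<in> S \<Longrightarrow> \<bar>f \<xi>\<bar> \<le> B" "0 \<le> B"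
    using bounded_on_S[OF f] by blast
  \<comment> \<open>\<open>f\<close> is bounded only on \<open>S\<close>, whereas conditioning on
    the first step needs a global bound; \<open>\<mu>\<close> and the kernel live on
    \<open>S\<close>, so the cutoff changes no expectation.\<close>
  define g where "g \<xi> = (if \<xi> \<in> S then f \<xi> else 0)" for \<xi>
  have "measure_pmf.expectation \<mu> (generator N lam f)
      = measure_pmf.expectation \<mu> (\<lambda>\<xi>. 2 * lu * N * (measure_pmf.expectation (kernel \<xi>) g - g \<xi>))"
  proof (rule expectation_cong_pmf)
    fix \<xi> assume "\<xi> \<in> set_pmf \<mu>"
    then have "\<xi> \<in> S" using \<mu> by blast
    moreover have "measure_pmf.expectation (kernel \<xi>) g = measure_pmf.expectation (kernel \<xi>) f"
      using set_kernel_subset by (intro expectation_cong_pmf) (auto simp: g_def)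
    ultimately show "generator N lam f \<xi> = 2 * lu * N * (measure_pmf.expectation (kernel \<xi>) g - g \<xi>)"
      by (simp add: generator_eq g_def)
  qed
  also have "\<dots> = 2 * lu * N * (measure_pmf.expectation \<mu> (\<lambda>\<xi>. measure_pmf.expectation (kernel \<xi>) g) - measure_pmf.expectation \<mu> g)"
    using B by (subst integral_mult_right_zero, subst Bochner_Integration.integral_diff)
      (auto intro!: integrable_pmf_bounded[where C = B] abs_expectation_le simp: g_def)
  also have "measure_pmf.expectation \<mu> (\<lambda>\<xi>. measure_pmf.expectation (kernel \<xi>) g) = measure_pmf.expectation (bind_pmf \<mu> kernel) g"
    using B by (intro expectation_bind_pmf_bounded[symmetric, of _ B]) (auto simp: g_def)
  also have "\<dots> = measure_pmf.expectation (bind_pmf \<mu> kernel) f"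
    using set_kernel_subset by (intro expectation_cong_pmf) (auto simp: g_def)
  also have "measure_pmf.expectation \<mu> g = measure_pmf.expectation \<mu> f"
    using \<mu> by (intro expectation_cong_pmf) (auto simp: g_def)
  finally show ?thesis .
qed

lemma invariant_measure_iff_stationary:
  "invariant_measure N lam \<mu> \<longleftrightarrow> bind_pmf \<mu> kernel = \<mu>"
proof
  assume st: "bind_pmf \<mu> kernel = \<mu>"
  have "set_pmf (bind_pmf \<mu> kernel) \<subseteq> S"
    using set_kernel_subset by auto
  then have \<mu>: "set_pmf \<mu> \<subseteq> S"
    by (simp add: st)
  then show "invariant_measure N lam \<mu>"
    by (simp add: invariant_measure_iff_generator expectation_generator st)
next
  assume "invariant_measure N lam \<mu>"
  then have \<mu>: "set_pmf \<mu> \<subseteq> S" and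
    gen: "\<And>f. bounded (f ` S) \<Longrightarrow> measure_pmf.expectation \<mu> (generator N lam f) = 0"
    by (auto simp: invariant_measure_iff_generator)
  show "bind_pmf \<mu> kernel = \<mu>"
  proof (rule pmf_eqI)
    fix \<eta>
    \<comment> \<open>Testing with the indicators of single points determines a discrete
      measure.\<close>
    have b: "bounded ((indicator {\<eta>} :: _ \<Rightarrow> real) ` S)"
      by (auto simp: bounded_iff indicator_def intro!: exI[of _ 1])
    show "pmf (bind_pmf \<mu> kernel) \<eta> = pmf \<mu> \<eta>"
      using expectation_generator[OF \<mu> b] gen[OF b] lu_pos N by (simp add: measure_pmf_single)
  qed
qed

lemma invariant_measure_ex1: "\<exists>!\<mu>. invariant_measure N lam \<mu>"
  using stationary_ex1 by (simp add: invariant_measure_iff_stationary)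

end

section \<open>Elementary symmetric functions of a multiset\<close>

lemma coeff_sum_mset: "coeff (\<Sum>x\<in>#M. p x) k = (\<Sum>x\<in>#M. coeff (p x) k)"
  by (induction M) auto

text \<open>The generating polynomial of the elementary symmetric functions: identities about
  removing one element become polynomial identities to be read off coefficientwise.\<close>

definition esym_poly :: "('a \<Rightarrow> real) \<Rightarrow> 'a multiset \<Rightarrow> real poly" where
  "esym_poly w M = (\<Prod>x\<in>#M. [:1, w x:])"

definition esym :: "('a \<Rightarrow> real) \<Rightarrow> nat \<Rightarrow> 'a multiset \<Rightarrow> real" where
  "esym w k M = coeff (esym_poly w M) k"

lemma esym_poly_add: "esym_poly w (add_mset a M) = [:1, w a:] * esym_poly w M"
  by (simp add: esym_poly_def)

lemma esym_0: "esym w 0 M = 1"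
  by (induction M) (auto simp: esym_def esym_poly_def)

lemma esym_Suc_add: "esym w (Suc k) (add_mset a M) = esym w (Suc k) M + w a * esym w k M"
  by (simp add: esym_def esym_poly_add)

lemma esym_nonneg:
  assumes "\<And>x. 0 \<le> w x"
  shows "0 \<le> esym w k M"
proof (induction M arbitrary: k)
  case empty
  show ?case by (cases k) (auto simp: esym_def esym_poly_def)
next
  case (add a M)
  then show ?case
    by (cases k) (auto simp: esym_0 esym_Suc_add assms)
qed

text \<open>Both sides are the generating polynomial evaluated at 1.\<close>

lemma sum_esym: "(\<Sum>k\<le>size M. esym w k M) = (\<Prod>x\<in>#M. 1 + w x)"
proof -
  have "degree (esym_poly w M) \<le> size M"
  proof (induction M)
    case (add a M)
    have "degree (esym_poly w (add_mset a M)) \<le> degree [:1, w a:] + degree (esym_poly w M)"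
      unfolding esym_poly_add by (rule degree_mult_le)
    also have "degree [:1, w a:] \<le> 1"
      by simp
    finally show ?case using add by simp
  qed (simp add: esym_poly_def)
  then have "(\<Sum>k\<le>size M. esym w k M) = poly (esym_poly w M) 1"
    unfolding esym_def poly_altdef by (simp, intro sum.mono_neutral_right) (auto simp: coeff_eq_0)
  also have "\<dots> = (\<Prod>x\<in>#M. 1 + w x)"
    by (induction M) (auto simp: esym_poly_def distrib_right)
  finally show ?thesis .
qed

text \<open>The common induction step of the two identities below: when another element is removed,
  the factor of \<open>a\<close> survives and can be pulled out.\<close>

lemma sum_mset_remove_esym_poly:
  "(\<Sum>x\<in>#add_mset a M. F x * esym_poly w (add_mset a M - {#x#}))
    = F a * esym_poly w M + [:1, w a:] * (\<Sum>x\<in>#M. F x * esym_poly w (M - {#x#}))"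
proof -
  have "(\<Sum>x\<in>#M. F x * esym_poly w (add_mset a M - {#x#}))
      = (\<Sum>x\<in>#M. [:1, w a:] * (F x * esym_poly w (M - {#x#})))"
  proof (intro arg_cong[of _ _ sum_mset] image_mset_cong)
    fix x assume "x \<in># M"
    then have "add_mset a M - {#x#} = add_mset a (M - {#x#})"
      by (cases "x = a") auto
    then show "F x * esym_poly w (add_mset a M - {#x#}) = [:1, w a:] * (F x * esym_poly w (M - {#x#}))"
      by (simp only: esym_poly_add mult_ac)
  qed
  then show ?thesis
    by (simp add: sum_mset_distrib_left)
qed

text \<open>The product rule: \<open>[:w x:]\<close> is the derivative of the factor
  \<open>[:1, w x:]\<close>.\<close>

lemma pderiv_esym_poly:
  "(\<Sum>x\<in>#M. [:w x:] * esym_poly w (M - {#x#})) = pderiv (esym_poly w M)"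
proof (induction M)
  case (add a M)
  then show ?case
    unfolding sum_mset_remove_esym_poly esym_poly_add pderiv_mult
    by (simp add: pderiv_pCons algebra_simps)
qed (simp add: esym_poly_def)

lemma size_esym_poly:
  "(\<Sum>x\<in>#M. [:1, w x:] * esym_poly w (M - {#x#})) = of_nat (size M) * esym_poly w M"
proof (induction M)
  case (add a M)
  then show ?case
    unfolding sum_mset_remove_esym_poly by (simp add: esym_poly_add algebra_simps smult_add_right)
qed simp

text \<open>The coefficient of degree \<open>k\<close> in the derivative of the generating
  polynomial.\<close>

lemma sum_mset_weighted_esym_remove:
  "(\<Sum>x\<in>#M. w x * esym w k (M - {#x#})) = (real k + 1) * esym w (Suc k) M"
proof -
  have "(\<Sum>x\<in>#M. w x * esym w k (M - {#x#})) = coeff (\<Sum>x\<in>#M. [:w x:] * esym_poly w (M - {#x#})) k"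
    unfolding coeff_sum_mset by (simp add: esym_def)
  then show ?thesis
    by (simp only: pderiv_esym_poly) (simp add: coeff_pderiv esym_def)
qed

text \<open>Restoring each removed factor gives \<open>size M\<close> copies of the generating
  polynomial P, and the weighted parts of those factors sum to X P'. What remains is
  \<open>size M\<close> times P minus X P', whose coefficients give the claim.\<close>

lemma sum_mset_esym_remove:
  "(\<Sum>x\<in>#M. esym w k (M - {#x#})) = (real (size M) - real k) * esym w k M"
proof -
  have "(\<Sum>x\<in>#M. [:1, w x:] * esym_poly w (M - {#x#}))
      = (\<Sum>x\<in>#M. esym_poly w (M - {#x#})) + [:0, 1:] * (\<Sum>x\<in>#M. [:w x:] * esym_poly w (M - {#x#}))"
    unfolding sum_mset_distrib_left sum_mset.distrib[symmetric]
    by (intro arg_cong[of _ _ sum_mset] image_mset_cong) (simp add: algebra_simps)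
  then have "(\<Sum>x\<in>#M. esym_poly w (M - {#x#}))
      = of_nat (size M) * esym_poly w M - pCons 0 (pderiv (esym_poly w M))"
    unfolding size_esym_poly pderiv_esym_poly by simp
  then have "(\<Sum>x\<in>#M. coeff (esym_poly w (M - {#x#})) k)
      = coeff (of_nat (size M) * esym_poly w M - pCons 0 (pderiv (esym_poly w M))) k"
    by (simp only: coeff_sum_mset[symmetric])
  then show ?thesis
    by (cases k) (simp_all add: esym_def coeff_pderiv algebra_simps of_nat_poly)
qed

section \<open>Triangular weights and their truncation\<close>

definition tri :: "nat \<Rightarrow> real" where
  "tri x = real x * (real x + 1) / 2"

lemma tri_0 [simp]: "tri 0 = 0"
  by (simp add: tri_def)

lemma tri_mono: "x \<le> y \<Longrightarrow> tri x \<le> tri y"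
  unfolding tri_def by (intro divide_right_mono mult_mono) auto

lemma tri_nonneg [simp]: "0 \<le> tri x"
  by (simp add: tri_def)

lemma tri_Suc: "tri (Suc x) = tri x + (real x + 1)"
  by (simp add: tri_def field_simps)

definition trunc :: "nat \<Rightarrow> nat \<Rightarrow> real" where
  "trunc m x = tri (min x m)"

lemma trunc_0 [simp]: "trunc m 0 = 0"
  and trunc_nonneg [simp]: "0 \<le> trunc m x"
  and trunc_le: "trunc m x \<le> tri m"
  by (auto simp: trunc_def intro: tri_mono)

text \<open>Cutting off the argument rather than the value makes each increment either the exact
  triangular one (below \<open>m\<close>) or 0 (from \<open>m\<close> on).\<close>

lemma trunc_step: "0 \<le> trunc m (Suc x) - trunc m x" "trunc m (Suc x) - trunc m x \<le> real x + 1"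
proof -
  show "0 \<le> trunc m (Suc x) - trunc m x"
    using tri_mono[of "min x m" "min (Suc x) m"] by (simp add: trunc_def)
  show "trunc m (Suc x) - trunc m x \<le> real x + 1"
    by (cases "x < m") (simp_all add: trunc_def tri_Suc min_def)
qed

lemma prod_mset_bounds:
  fixes w :: "'a \<Rightarrow> real"
  assumes "\<And>x. 0 \<le> w x" "\<And>x. w x \<le> B"
  shows "1 \<le> (\<Prod>x\<in>#M. 1 + w x) \<and> (\<Prod>x\<in>#M. 1 + w x) \<le> (1 + B) ^ size M"
proof (induction M)
  case (add a M)
  have "1 * 1 \<le> (1 + w a) * (\<Prod>x\<in>#M. 1 + w x)"
    using add assms(1)[of a] by (intro mult_mono) auto
  moreover have "(1 + w a) * (\<Prod>x\<in>#M. 1 + w x) \<le> (1 + B) * (1 + B) ^ size M"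
    using add assms[of a] by (intro mult_mono) auto
  ultimately show ?case by simp
qed simp

section \<open>Exponential moments of an invariant measure\<close>

context mean_field
begin

text \<open>Recovers the unordered configuration, which is possible since multiplicities are
  \<open>N\<close> times the masses; it is meaningful only on \<open>S\<close>.\<close>

definition mset_of :: "nat pmf \<Rightarrow> nat multiset" where
  "mset_of = the_inv_into {M. size M = N} emp"

lemma mset_of_emp: "size M = N \<Longrightarrow> mset_of (emp M) = M"
proof -
  have "inj_on emp {M. size M = N}"
  proof (rule inj_onI, rule multiset_eqI)
    fix M M' x assume "M \<in> {M. size M = N}" "M' \<in> {M. size M = N}" "emp M = emp M'"
    then have "real (count M x) / N = real (count M' x) / N"
      by (metis mem_Collect_eq pmf_emp)
    then show "count M x = count M' x"
      using N by simp
  qed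
  then show "size M = N \<Longrightarrow> mset_of (emp M) = M"
    by (simp add: mset_of_def the_inv_into_f_f)
qed

definition sym_moment :: "nat \<Rightarrow> nat \<Rightarrow> nat pmf \<Rightarrow> real" where
  "sym_moment m k \<xi> = esym (trunc m) k (mset_of \<xi>)"

definition weight :: "nat \<Rightarrow> nat pmf \<Rightarrow> real" where
  "weight m \<xi> = (\<Prod>x\<in>#mset_of \<xi>. 1 + trunc m x)"

lemma size_mset_of: "\<xi> \<in> S \<Longrightarrow> size (mset_of \<xi>) = N"
  unfolding S_eq using mset_of_emp by force

lemma sum_sym_moment: "\<xi> \<in> S \<Longrightarrow> (\<Sum>k\<le>N. sym_moment m k \<xi>) = weight m \<xi>"
  using sum_esym[of "trunc m" "mset_of \<xi>"] by (simp add: sym_moment_def weight_def size_mset_of)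

lemma weight_ge_1: "1 \<le> weight m \<xi>"
  unfolding weight_def using prod_mset_bounds[of "trunc m" "tri m"] by (simp add: trunc_le)

lemma weight_le: "\<xi> \<in> S \<Longrightarrow> weight m \<xi> \<le> (1 + tri m) ^ N"
  unfolding weight_def using prod_mset_bounds[of "trunc m" "tri m" "mset_of \<xi>"]
  by (simp add: trunc_le size_mset_of)

lemma sym_moment_nonneg: "0 \<le> sym_moment m k \<xi>"
  by (simp add: sym_moment_def esym_nonneg)

lemma sym_moment_le:
  assumes "\<xi> \<in> S" "k \<le> N"
  shows "sym_moment m k \<xi> \<le> (1 + tri m) ^ N"
proof -
  have "sym_moment m k \<xi> \<le> (\<Sum>k\<le>N. sym_moment m k \<xi>)"
    using assms by (intro member_le_sum) (auto simp: sym_moment_nonneg)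
  then show ?thesis
    using assms weight_le[of \<xi> m] by (simp add: sum_sym_moment)
qed

text \<open>An elementary symmetric function is affine in the weight of each particle, so a jump
  changes it by the change of weight times the next lower function of the other particles. Upward
  jumps then contribute at most \<open>lu\<close> because the weight grows by at most
  \<open>z + 1\<close>.\<close>

lemma drift_sym_moment_le:
  assumes M: "size M = N" and z: "z \<in># M"
  shows "drift (sym_moment m (Suc k)) (emp M) z \<le> (lu - ll * trunc m z) * esym (trunc m) k (M - {#z#})"
proof -
  let ?e = "esym (trunc m) k (M - {#z#})"
  have inc: "sym_moment m (Suc k) (jump N z z' (emp M)) - sym_moment m (Suc k) (emp M)
      = (trunc m z' - trunc m z) * ?e" for z'
  proof -
    have "size (add_mset z' (M - {#z#})) = N"
      using M z N by (simp add: size_Suc_Diff1)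
    moreover have "esym (trunc m) (Suc k) M = esym (trunc m) (Suc k) (add_mset z (M - {#z#}))"
      using z by simp
    ultimately show ?thesis
      using M z by (simp add: jump_emp sym_moment_def mset_of_emp esym_Suc_add algebra_simps
          del: insert_DiffM)
  qed
  have "lam z (z + 1) (emp M) * (trunc m (z + 1) - trunc m z) \<le> lu / (real z + 1) * (real z + 1)"
    using trunc_step[of m z] up[of z "emp M"] lu_pos by (intro mult_mono) auto
  then have "lam z (z + 1) (emp M) * (trunc m (z + 1) - trunc m z) \<le> lu"
    by (simp add: add_eq_0_iff)
  moreover have "(if z = 0 then 0 else lam z 0 (emp M) * (trunc m 0 - trunc m z)) \<le> - ll * trunc m z"
    using down(1)[of z "emp M"] by (auto intro: mult_right_mono)
  ultimately have "(lam z (z + 1) (emp M) * (trunc m (z + 1) - trunc m z)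
      + (if z = 0 then 0 else lam z 0 (emp M) * (trunc m 0 - trunc m z))) * ?e \<le> (lu - ll * trunc m z) * ?e"
    by (intro mult_right_mono esym_nonneg) auto
  then show ?thesis
    unfolding drift_def inc by (simp add: algebra_simps split: if_splits)
qed

text \<open>Summing the one-particle bounds, the two removal identities convert the functions of the
  other particles back into functions of the whole configuration.\<close>

lemma generator_sym_moment_le:
  assumes "\<xi> \<in> S"
  shows "generator N lam (sym_moment m (Suc k)) \<xi>
    \<le> lu * (real N - real k) * sym_moment m k \<xi> - ll * (real k + 1) * sym_moment m (Suc k) \<xi>"
proof -
  obtain M where M: "size M = N" "\<xi> = emp M"
    using assms by (auto simp: S_eq)
  let ?w = "trunc m"
  have "generator N lam (sym_moment m (Suc k)) \<xi> \<le> (\<Sum>z\<in>#M. (lu - ll * ?w z) * esym ?w k (M - {#z#}))"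
    using M by (simp add: generator_emp) (intro sum_mset_mono drift_sym_moment_le)
  also have "\<dots> = (\<Sum>z\<in>#M. lu * esym ?w k (M - {#z#}) + (- ll) * (?w z * esym ?w k (M - {#z#})))"
    by (intro arg_cong[of _ _ sum_mset] image_mset_cong) (simp add: algebra_simps)
  also have "\<dots> = lu * (\<Sum>z\<in>#M. esym ?w k (M - {#z#})) + (- ll) * (\<Sum>z\<in>#M. ?w z * esym ?w k (M - {#z#}))"
    by (simp only: sum_mset.distrib sum_mset_distrib_left)
  finally show ?thesis
    using M by (simp add: sum_mset_esym_remove sum_mset_weighted_esym_remove sym_moment_def mset_of_emp)
qed

text \<open>The generator has mean 0, so its upper bound has nonnegative mean: a recursion in
  \<open>k\<close> that the claimed bound solves with equality.\<close>

lemma expectation_sym_moment_le: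
  assumes inv: "invariant_measure N lam \<mu>" and "k \<le> N"
  shows "measure_pmf.expectation \<mu> (sym_moment m k) \<le> (lu / ll) ^ k * real (N choose k)"
  using assms(2)
proof (induction k)
  case 0
  then show ?case by (simp add: sym_moment_def esym_0)
next
  case (Suc k)
  have \<mu>: "set_pmf \<mu> \<subseteq> S" and gen: "\<And>f. bounded (f ` S) \<Longrightarrow> measure_pmf.expectation \<mu> (generator N lam f) = 0"
    using inv by (auto simp: invariant_measure_iff_generator)
  let ?E = "\<lambda>k. measure_pmf.expectation \<mu> (sym_moment m k)"
  have abs: "\<bar>sym_moment m j \<xi>\<bar> \<le> (1 + tri m) ^ N" if "\<xi> \<in> S" "j \<le> N" for j \<xi>
    using that sym_moment_le[of \<xi> j m] sym_moment_nonneg[of m j \<xi>] by simp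
  have int: "integrable (measure_pmf \<mu>) (sym_moment m j)" if "j \<le> N" for j
    using abs that \<mu> by (intro integrable_pmf_bounded[where C = "(1 + tri m) ^ N"]) blast
  have "0 = measure_pmf.expectation \<mu> (generator N lam (sym_moment m (Suc k)))"
    using Suc.prems abs by (intro gen[symmetric]) (auto simp: bounded_iff intro!: exI[of _ "(1 + tri m) ^ N"])
  also have "\<dots> \<le> measure_pmf.expectation \<mu>
      (\<lambda>\<xi>. lu * (real N - real k) * sym_moment m k \<xi> - ll * (real k + 1) * sym_moment m (Suc k) \<xi>)"
  proof (rule integral_mono_AE)
    have "\<bar>generator N lam (sym_moment m (Suc k)) \<xi>\<bar> \<le> 4 * lu * N * (1 + tri m) ^ N" if "\<xi> \<in> S" for \<xi>
      using generator_pow_bound[of "sym_moment m (Suc k)" "(1 + tri m) ^ N" \<xi> 1] abs that Suc.prems by simp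
    then show "integrable (measure_pmf \<mu>) (generator N lam (sym_moment m (Suc k)))"
      using \<mu> by (intro integrable_pmf_bounded[where C = "4 * lu * N * (1 + tri m) ^ N"]) blast
  qed (use Suc.prems int \<mu> generator_sym_moment_le in \<open>auto simp: AE_measure_pmf_iff\<close>)
  also have "\<dots> = lu * (real N - real k) * ?E k - ll * (real k + 1) * ?E (Suc k)"
    using Suc.prems int by (subst Bochner_Integration.integral_diff) auto
  finally have "ll * (real k + 1) * ?E (Suc k) \<le> lu * (real N - real k) * ?E k"
    by simp
  also have "\<dots> \<le> lu * (real N - real k) * ((lu / ll) ^ k * real (N choose k))"
    using Suc lu_pos by (intro mult_left_mono) auto
  also have "\<dots> = lu * (lu / ll) ^ k * (real (N - k) * real (N choose k))"
    using Suc.prems by (simp add: of_nat_diff)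
  \<comment> \<open>Both sides equal \<open>N\<close> times a binomial coefficient with upper index
    \<open>N - 1\<close> and lower index \<open>k\<close>.\<close>
  also have "real (N - k) * real (N choose k) = (real k + 1) * real (N choose Suc k)"
    using binomial_absorb_comp[of N k] binomial_absorption[of k N]
    by (metis of_nat_Suc of_nat_mult add.commute)
  also have "lu * (lu / ll) ^ k * ((real k + 1) * real (N choose Suc k))
      = ll * (real k + 1) * ((lu / ll) ^ Suc k * real (N choose Suc k))"
    using ll_pos by simp
  finally show ?case
    using ll_pos by (subst (asm) mult_le_cancel_left_pos) auto
qed

lemma expectation_weight_le:
  assumes inv: "invariant_measure N lam \<mu>"
  shows "measure_pmf.expectation \<mu> (weight m) \<le> (1 + lu / ll) ^ N"
proof -
  have \<mu>: "set_pmf \<mu> \<subseteq> S"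
    using inv by (simp add: invariant_measure_def)
  have "measure_pmf.expectation \<mu> (weight m) = measure_pmf.expectation \<mu> (\<lambda>\<xi>. \<Sum>k\<le>N. sym_moment m k \<xi>)"
    using \<mu> by (intro expectation_cong_pmf) (auto simp: sum_sym_moment)
  also have "\<dots> = (\<Sum>k\<le>N. measure_pmf.expectation \<mu> (sym_moment m k))"
    using \<mu> sym_moment_le sym_moment_nonneg
    by (intro Bochner_Integration.integral_sum integrable_pmf_bounded[where C = "(1 + tri m) ^ N"])
      (auto simp: abs_of_nonneg)
  also have "\<dots> \<le> (\<Sum>k\<le>N. (lu / ll) ^ k * real (N choose k))"
    using inv by (intro sum_mono expectation_sym_moment_le) auto
  also have "\<dots> = (lu / ll + 1) ^ N"
    by (subst binomial_ring) (simp add: mult.commute)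
  finally show ?thesis by (simp add: add.commute)
qed

section \<open>Removing the truncation\<close>

definition full_weight :: "nat pmf \<Rightarrow> real" where
  "full_weight \<xi> = (\<Prod>x\<in>#mset_of \<xi>. 1 + tri x)"

lemma weight_incseq: "m \<le> m' \<Longrightarrow> weight m \<xi> \<le> weight m' \<xi>"
proof -
  assume m: "m \<le> m'"
  have "0 \<le> (\<Prod>x\<in>#M. 1 + trunc m x) \<and> (\<Prod>x\<in>#M. 1 + trunc m x) \<le> (\<Prod>x\<in>#M. 1 + trunc m' x)" for M
  proof (induction M)
    case (add a M)
    have "trunc m a \<le> trunc m' a"
      unfolding trunc_def using m by (intro tri_mono) auto
    then show ?case
      using add by (auto intro!: mult_mono mult_nonneg_nonneg add_nonneg_nonneg)
  qed simp
  then show ?thesis by (simp add: weight_def)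
qed

lemma full_weight_eq_weight: "\<exists>m. full_weight \<xi> = weight m \<xi>"
proof -
  \<comment> \<open>The sum of all positions bounds each of them, so truncation at that level has no
    effect.\<close>
  have "\<forall>x\<in>#M. x \<le> sum_mset M" for M :: "nat multiset"
    by (auto dest: multi_member_split)
  then show ?thesis
    unfolding full_weight_def weight_def
    by (intro exI[of _ "sum_mset (mset_of \<xi>)"] arg_cong[of _ _ prod_mset] image_mset_cong)
       (simp add: trunc_def)
qed

text \<open>Markov's inequality at each truncation level gives a bound independent of
  \<open>m\<close>; the truncated events increase with \<open>m\<close> and cover the full
  one.\<close>

lemma prob_full_weight_le:
  assumes inv: "invariant_measure N lam \<mu>" and r: "0 < r"
  shows "measure_pmf.prob \<mu> {\<xi>. r < full_weight \<xi>} \<le> (1 + lu / ll) ^ N / r"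
proof -
  have \<mu>: "set_pmf \<mu> \<subseteq> S"
    using inv by (simp add: invariant_measure_def)
  have m: "measure_pmf.prob \<mu> {\<xi>. r < weight m \<xi>} \<le> (1 + lu / ll) ^ N / r" for m
  proof -
    have int: "integrable (measure_pmf \<mu>) (weight m)"
      using \<mu> weight_le weight_ge_1
      by (intro integrable_pmf_bounded[where C = "(1 + tri m) ^ N"]) (smt (verit) subsetD)
    have "measure_pmf.prob \<mu> {\<xi>. r < weight m \<xi>} = measure_pmf.expectation \<mu> (indicator {\<xi>. r < weight m \<xi>})"
      by simp
    also have "\<dots> \<le> measure_pmf.expectation \<mu> (\<lambda>\<xi>. weight m \<xi> / r)"
    proof (rule integral_mono)
      fix \<xi>
      show "indicator {\<xi>. r < weight m \<xi>} \<xi> \<le> weight m \<xi> / r"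
        using r weight_ge_1[of m \<xi>] by (auto simp: indicator_def)
    qed (use int in \<open>auto intro: integrable_pmf_bounded[where C = 1]\<close>)
    also have "\<dots> \<le> (1 + lu / ll) ^ N / r"
      using expectation_weight_le[OF inv, of m] r by (simp add: divide_right_mono)
    finally show ?thesis .
  qed
  have lim: "(\<lambda>m. measure_pmf.prob \<mu> {\<xi>. r < weight m \<xi>}) \<longlonglongrightarrow> measure_pmf.prob \<mu> (\<Union>m. {\<xi>. r < weight m \<xi>})"
    by (rule measure_pmf.finite_Lim_measure_incseq)
      (auto simp: incseq_def intro: less_le_trans weight_incseq)
  have "measure_pmf.prob \<mu> {\<xi>. r < full_weight \<xi>} \<le> measure_pmf.prob \<mu> (\<Union>m. {\<xi>. r < weight m \<xi>})"
    using full_weight_eq_weight by (intro measure_pmf.finite_measure_mono) (auto, metis)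
  also have "\<dots> \<le> (1 + lu / ll) ^ N / r"
    using lim m by (intro LIMSEQ_le_const2) auto
  finally show ?thesis .
qed

end

section \<open>Exponential tightness\<close>

text \<open>The Markov consequence of a bound \<open>R\<close> on the mean of
  \<open>ln (1 + tri x)\<close>; stated through tails, it avoids an integral that may
  diverge.\<close>

definition tail_bounded :: "real \<Rightarrow> nat pmf set" where
  "tail_bounded R = {\<xi>. \<forall>k. ln (1 + tri k) * measure_pmf.prob \<xi> {k..} \<le> R}"

lemma compactin_closure_tail_bounded:
  "compactin tv.mtopology (tv.mtopology closure_of tail_bounded R)"
proof -
  have "tv.mtotally_bounded (tail_bounded R)"
  proof (rule tv_mtotally_bounded)
    fix \<epsilon> :: real assume \<epsilon>: "0 < \<epsilon>"
    \<comment> \<open>Since \<open>tri k \<ge> k\<close> for \<open>k \<ge> 1\<close>, this makes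
      \<open>ln (1 + tri k)\<close> exceed \<open>\<bar>R\<bar> / \<epsilon>\<close>; the absolute
      value covers negative \<open>R\<close>.\<close>
    obtain k where k: "exp (\<bar>R\<bar> / \<epsilon>) \<le> real k"
      using real_arch_simple by blast
    have "1 \<le> exp (\<bar>R\<bar> / \<epsilon>)"
      using \<epsilon> by simp
    then have k1: "1 \<le> real k"
      using k by (rule order_trans)
    have "real k * 2 \<le> real k * (real k + 1)"
      using k1 by (intro mult_left_mono) auto
    then have "real k \<le> tri k"
      by (simp add: tri_def)
    then have lt: "exp (\<bar>R\<bar> / \<epsilon>) < 1 + tri k"
      using k by simp
    have "\<bar>R\<bar> / \<epsilon> < ln (1 + tri k)"
      using ln_less_cancel_iff[of "exp (\<bar>R\<bar> / \<epsilon>)" "1 + tri k"] lt tri_nonneg[of k]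
      by (simp add: add_pos_nonneg)
    then have l: "\<bar>R\<bar> < ln (1 + tri k) * \<epsilon>"
      using \<epsilon> by (simp add: pos_divide_less_eq)
    then have "0 < ln (1 + tri k)"
      using \<epsilon> by (smt (verit) zero_less_mult_pos2)
    have "measure_pmf.prob \<xi> {k..} \<le> \<epsilon>" if "\<xi> \<in> tail_bounded R" for \<xi>
    proof (rule ccontr)
      assume "\<not> measure_pmf.prob \<xi> {k..} \<le> \<epsilon>"
      then have "ln (1 + tri k) * \<epsilon> \<le> ln (1 + tri k) * measure_pmf.prob \<xi> {k..}"
        using \<open>0 < ln (1 + tri k)\<close> by (intro mult_left_mono) auto
      also have "\<dots> \<le> R"
        using that by (simp add: tail_bounded_def)
      finally show False using l by simp
    qed
    then show "\<exists>k. \<forall>\<xi>\<in>tail_bounded R. measure_pmf.prob \<xi> {k..} \<le> \<epsilon>"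
      by blast
  qed
  then show ?thesis
    using tv.mtotally_bounded_eq_compact_closure_of[OF tv_mcomplete] by blast
qed

section \<open>Concentration of invariant measures on \<open>tail_bounded\<close>\<close>

context mean_field
begin

text \<open>The logarithm of the product is a sum over particles; each of the particles at
  \<open>k\<close> or beyond contributes at least \<open>ln (1 + tri k)\<close>, the others at least
  0.\<close>

lemma ln_full_weight_ge:
  assumes "\<xi> \<in> S"
  shows "real N * (ln (1 + tri k) * measure_pmf.prob \<xi> {k..}) \<le> ln (full_weight \<xi>)"
proof -
  obtain M where M: "size M = N" "\<xi> = emp M"
    using assms by (auto simp: S_eq)
  have "measure_pmf.prob \<xi> {k..} = measure_pmf.expectation \<xi> (indicator {k..})"
    by simp
  also have "\<dots> = (\<Sum>x\<in>set_mset M. pmf \<xi> x * indicator {k..} x)"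
    using M by (subst integral_measure_pmf[of "set_mset M"]) (auto simp: set_emp)
  finally have "real N * measure_pmf.prob \<xi> {k..} = (\<Sum>x\<in>#M. indicator {k..} x)"
    using M N by (simp add: sum_image_mset_count pmf_emp sum_distrib_left)
  then have "real N * (ln (1 + tri k) * measure_pmf.prob \<xi> {k..}) = ln (1 + tri k) * (\<Sum>x\<in>#M. indicator {k..} x)"
    by (simp add: mult.left_commute)
  also have "\<dots> = (\<Sum>x\<in>#M. ln (1 + tri k) * indicator {k..} x)"
    by (rule sum_mset_distrib_left)
  also have "\<dots> \<le> (\<Sum>x\<in>#M. ln (1 + tri x))"
    by (intro sum_mset_mono) (auto simp: indicator_def add_pos_nonneg intro: tri_mono)
  also have "\<dots> = ln (\<Prod>x\<in>#M. 1 + tri x)"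
  proof -
    have "0 < (\<Prod>x\<in>#M. 1 + tri x) \<and> (\<Sum>x\<in>#M. ln (1 + tri x)) = ln (\<Prod>x\<in>#M. 1 + tri x)"
    proof (induction M)
      case (add a M)
      have "0 < 1 + tri a" by (simp add: add_pos_nonneg)
      with add show ?case
        by (simp only: image_mset_add_mset prod_mset.add_mset sum_mset.add_mset mult_pos_pos ln_mult_pos)
    qed simp
    then show ?thesis by simp
  qed
  finally show ?thesis
    using M by (simp add: full_weight_def mset_of_emp)
qed

text \<open>On the support of \<open>\<mu>\<close>, a tail bound violated at a single
  \<open>k\<close> already pushes \<open>full_weight\<close> above \<open>exp (real N * R)\<close>,
  a threshold whose exponent grows with \<open>N\<close> like that of the moment bound.\<close>

lemma prob_not_tail_bounded_le:
  assumes inv: "invariant_measure N lam \<mu>"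
  shows "measure_pmf.prob \<mu> (- tail_bounded R) \<le> ((1 + lu / ll) / exp R) ^ N"
proof -
  have \<mu>: "set_pmf \<mu> \<subseteq> S"
    using inv by (simp add: invariant_measure_def)
  have "measure_pmf.prob \<mu> (- tail_bounded R) = measure_pmf.prob \<mu> (- tail_bounded R \<inter> set_pmf \<mu>)"
    by (simp add: measure_Int_set_pmf)
  also have "\<dots> \<le> measure_pmf.prob \<mu> {\<xi>. exp (real N * R) < full_weight \<xi>}"
  proof (intro measure_pmf.finite_measure_mono subsetI)
    fix \<xi> assume *: "\<xi> \<in> - tail_bounded R \<inter> set_pmf \<mu>"
    then obtain k where k: "R < ln (1 + tri k) * measure_pmf.prob \<xi> {k..}"
      by (auto simp: tail_bounded_def not_le)
    have "real N * R < real N * (ln (1 + tri k) * measure_pmf.prob \<xi> {k..})"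
      using k N by simp
    also have "\<dots> \<le> ln (full_weight \<xi>)"
      using * \<mu> by (intro ln_full_weight_ge) blast
    finally have "exp (real N * R) < exp (ln (full_weight \<xi>))"
      by simp
    moreover have "0 < full_weight \<xi>"
      using full_weight_eq_weight[of \<xi>] weight_ge_1[of _ \<xi>] by (metis less_le_trans zero_less_one)
    ultimately show "\<xi> \<in> {\<xi>. exp (real N * R) < full_weight \<xi>}"
      by simp
  qed simp
  also have "\<dots> \<le> (1 + lu / ll) ^ N / exp (real N * R)"
    using inv by (intro prob_full_weight_le) auto
  also have "\<dots> = ((1 + lu / ll) / exp R) ^ N"
    by (simp add: power_divide exp_of_nat_mult)
  finally show ?thesis .
qed

end

theorem proposition1p1:
  fixes lam :: "nat \<Rightarrow> nat \<Rightarrow> nat pmf \<Rightarrow> real"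
    and lam_lower lam_upper :: real
  assumes nonneg: "\<And>z z' \<xi>. (z, z') \<in> edges \<Longrightarrow> lam z z' \<xi> \<ge> 0"
    and pos: "lam_lower > 0" "lam_upper > 0"
    and up: "\<And>z \<xi>. lam_lower / (real z + 1) \<le> lam z (z + 1) \<xi> \<and>
                       lam z (z + 1) \<xi> \<le> lam_upper / (real z + 1)"
    and down: "\<And>z \<xi>. z \<noteq> 0 \<Longrightarrow> lam_lower \<le> lam z 0 \<xi> \<and> lam z 0 \<xi> \<le> lam_upper"
  shows "(\<forall>N\<ge>1. \<exists>!\<mu>. invariant_measure N lam \<mu>) \<and>
         (\<forall>P. (\<forall>N\<ge>1. invariant_measure N lam (P N)) \<longrightarrow> exponentially_tight P)"
proof -
  \<comment> \<open>The rate constants are the same for all \<open>N\<close>, so one set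
    \<open>K\<close> can serve every \<open>N\<close>.\<close>
  have mf: "mean_field N lam lam_lower lam_upper" if "N \<ge> 1" for N
  proof
    show "0 \<le> lam z (z + 1) \<xi>" for z \<xi>
      by (rule nonneg) (simp add: edges_def)
  qed (use that pos up down in auto)
  show ?thesis
  proof (intro conjI allI impI)
    show "\<exists>!\<mu>. invariant_measure N lam \<mu>" if "N \<ge> 1" for N
      using that by (rule mean_field.invariant_measure_ex1[OF mf])
  next
    fix P assume P: "\<forall>N\<ge>1. invariant_measure N lam (P N)"
    show "exponentially_tight P"
      unfolding exponentially_tight_def
    proof (intro allI impI)
      fix M :: real
      define b where "b = 1 + lam_upper / lam_lower"
      \<comment> \<open>The shift by \<open>ln b\<close> absorbs the moment constant
        \<open>b\<close>, leaving exactly \<open>exp (- M)\<close> per particle. Closing the set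
        gives compactness and only shrinks its complement.\<close>
      define K where "K = tv.mtopology closure_of tail_bounded (M + ln b)"
      have b: "0 < b"
        using pos by (simp add: b_def add_pos_pos)
      have eq: "(1 + lam_upper / lam_lower) / exp (M + ln b) = exp (- M)"
        using b unfolding b_def[symmetric] by (simp add: exp_add exp_minus field_simps)
      have "- tail_bounded (M + ln b) \<supseteq> UNIV - K"
        using closure_of_subset[of "tail_bounded (M + ln b)" tv.mtopology] by (auto simp: K_def)
      then have "measure_pmf.prob (P N) (UNIV - K) \<le> measure_pmf.prob (P N) (- tail_bounded (M + ln b))" for N
        by (intro measure_pmf.finite_measure_mono) auto
      moreover have "measure_pmf.prob (P N) (- tail_bounded (M + ln b)) \<le> exp (- M) ^ N" if "N \<ge> 1" for N
        using mean_field.prob_not_tail_bounded_le[OF mf[OF that], of "P N" "M + ln b"] P that b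
        by (simp add: eq)
      ultimately have le: "measure_pmf.prob (P N) (UNIV - K) \<le> exp (- M) ^ N" if "N \<ge> 1" for N
        using that order_trans by blast
      have "ereal (1 / real N) * elog (measure_pmf.prob (P N) (UNIV - K)) \<le> ereal (- M)" if N: "N \<ge> 1" for N
      \<comment> \<open>At probability 0 the value of \<open>elog\<close> is minus infinity and the
        bound is immediate; otherwise logarithms may be taken.\<close>
      proof (cases "measure_pmf.prob (P N) (UNIV - K) = 0")
        case True
        then show ?thesis
          using N by (simp add: elog_def)
      next
        case False
        then have "ln (measure_pmf.prob (P N) (UNIV - K)) \<le> ln (exp (- M) ^ N)"
          using le[OF N] by (intro ln_mono) (auto simp: zero_less_measure_iff)
        also have "\<dots> = real N * - M"
          by (simp add: ln_realpow)
        finally have "1 / real N * ln (measure_pmf.prob (P N) (UNIV - K)) \<le> - M"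
          using N by (simp add: field_simps)
        then show ?thesis
          using False by (simp add: elog_def)
      qed
      then have "limsup (\<lambda>N. ereal (1 / real N) * elog (measure_pmf.prob (P N) (UNIV - K))) \<le> ereal (- M)"
        \<comment> \<open>The bound is known from \<open>N = 1\<close> on, which is enough for the
          limsup; \<open>P 0\<close> is arbitrary.\<close>
        by (intro Limsup_bounded) (auto simp: eventually_sequentially)
      then show "\<exists>K. compactin tv.mtopology K \<and>
          limsup (\<lambda>N. ereal (1 / real N) * elog (measure_pmf.prob (P N) (UNIV - K))) \<le> ereal (- M)"
        using compactin_closure_tail_bounded unfolding K_def by blast
    qed
  qed
qed

end
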